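(* Let $d\geq 4$. For all sufficiently large $n$, for every integer $f$ with $\sqrt{2n}\,n\leq f\leq f_{max}(n,d)$ there exists an arrangement of $n$ distinct hyperplanes in $\mathbb{RP}^d$ with exactly $f$ regions.
   Context: An arrangement of $n$ hyperplanes in real projective space $\mathbb{RP}^d$ is a set of $n$ distinct projective hyperplanes. Its number of regions is the number of connected components of the complement in $\mathbb{RP}^d$ of the union of its hyperplanes. $f_{max}(n,d)$ denotes the maximal possible number of regions of an arrangement of $n$ hyperplanes in $\mathbb{RP}^d$; for $n\geq d+1$ it equals $\sum_{i=0}^{d}\binom{n-1}{i}$. *)

theory Defs
  imports "HOL-Analysis.Analysis"
begin

text \<open>
  If \<open>'n\<close> has \<open>d + 1\<close> elements, \<open>'n proj_space\<close> is \<open>RP\<^sup>d\<close>: its points are the lines through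
  the origin of \<open>real ^ 'n\<close> (so \<open>'n\<close> indexes the homogeneous coordinates).
\<close>

typedef 'n proj_space = "{L :: (real ^ 'n :: finite) set. subspace L \<and> dim L = 1}"
  morphisms line_of Abs_proj_space
proof -
  obtain b :: "real ^ 'n" where "b \<in> Basis"
    using nonempty_Basis by blast
  then have "subspace (span {b}) \<and> dim (span {b}) = 1"
    by (auto simp: dim_insert)
  then show ?thesis
    by blast
qed

definition proj_point :: "real ^ 'n \<Rightarrow> 'n :: finite proj_space"
  where "proj_point x = Abs_proj_space (span {x})"

text \<open>The value \<open>proj_point 0\<close> is meaningless, so \<open>0\<close> is always excluded.\<close>

lemma line_of_proj_point: "x \<noteq> 0 \<Longrightarrow> line_of (proj_point x) = span {x}"
  unfolding proj_point_def by (rule Abs_proj_space_inverse) (auto simp: dim_insert)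

text \<open>
  The quotient topology of \<open>real ^ 'n - {0}\<close>. The preimage lies in the open set \<open>- {0}\<close>, so
  being open in the subspace is the same as being open in \<open>real ^ 'n\<close>.
\<close>

instantiation proj_space :: (finite) topological_space
begin

definition open_proj_space :: "'a proj_space set \<Rightarrow> bool"
  where "open_proj_space U \<longleftrightarrow> open {x. x \<noteq> 0 \<and> proj_point x \<in> U}"

instance
proof
  have "{x :: real ^ 'a. x \<noteq> 0 \<and> proj_point x \<in> UNIV} = - {0}"
    by auto
  then show "open (UNIV :: 'a proj_space set)"
    unfolding open_proj_space_def by (metis open_Compl closed_singleton)
next
  fix S T :: "'a proj_space set"
  assume "open S" "open T"
  moreover have "{x. x \<noteq> 0 \<and> proj_point x \<in> S \<inter> T} =
      {x. x \<noteq> 0 \<and> proj_point x \<in> S} \<inter> {x. x \<noteq> 0 \<and> proj_point x \<in> T}"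
    by auto
  ultimately show "open (S \<inter> T)"
    unfolding open_proj_space_def by (simp add: open_Int)
next
  fix K :: "'a proj_space set set"
  assume "\<forall>S\<in>K. open S"
  moreover have "{x. x \<noteq> 0 \<and> proj_point x \<in> \<Union>K} =
      (\<Union>S\<in>K. {x. x \<noteq> 0 \<and> proj_point x \<in> S})"
    by auto
  ultimately show "open (\<Union>K)"
    unfolding open_proj_space_def by (simp add: open_UN)
qed

end

lemma proj_point_surj:
  fixes p :: "'n :: finite proj_space"
  obtains x where "x \<noteq> 0" "p = proj_point x"
proof -
  have L: "subspace (line_of p)" "dim (line_of p) = 1"
    using line_of[of p] by auto
  then obtain x where x: "x \<in> line_of p" "x \<noteq> 0"
    using dim_eq_0[of "line_of p"] by auto
  have "span {x} \<subseteq> line_of p"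
    using L(1) x(1) by (simp add: span_minimal)
  moreover have "dim (span {x}) = 1"
    using x(2) by (simp add: dim_insert)
  ultimately have "span {x} = line_of p"
    using L by (intro subspace_dim_equal) auto
  then have "proj_point x = p"
    unfolding proj_point_def by (simp add: line_of_inverse)
  with x(2) show thesis
    using that by blast
qed

lemma quotient_map_proj_point:
  "quotient_map (top_of_set (- {0 :: real ^ 'n :: finite})) euclidean proj_point"
proof -
  have "proj_point ` (- {0 :: real ^ 'n}) = UNIV"
  proof (rule set_eqI)
    fix p :: "'n proj_space"
    obtain x where "x \<noteq> 0" "p = proj_point x"
      by (rule proj_point_surj)
    then show "p \<in> proj_point ` (- {0 :: real ^ 'n}) \<longleftrightarrow> p \<in> UNIV"
      by simp
  qed
  moreover have "openin (top_of_set (- {0 :: real ^ 'n})) {x \<in> - {0}. proj_point x \<in> U} \<longleftrightarrow> open U"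
    for U :: "'n proj_space set"
    by (subst openin_open_eq) (auto simp: open_proj_space_def)
  ultimately show ?thesis
    unfolding quotient_map_def by simp
qed

definition proj_hyperplane :: "'n :: finite proj_space set \<Rightarrow> bool"
  where "proj_hyperplane H \<longleftrightarrow>
    (\<exists>W :: (real ^ 'n) set. subspace W \<and> dim W = CARD('n) - 1 \<and> H = {p. line_of p \<subseteq> W})"

definition arrangements :: "nat \<Rightarrow> 'n :: finite proj_space set set set"
  where "arrangements n = {A. finite A \<and> card A = n \<and> (\<forall>H\<in>A. proj_hyperplane H)}"

definition num_regions :: "'n :: finite proj_space set set \<Rightarrow> nat"
  where "num_regions A = card (components (- \<Union>A))"

text \<open>\<open>f_max TYPE('n) n\<close> is \<open>f_max(n, d)\<close> for \<open>d = CARD('n) - 1\<close>.\<close>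

definition f_max :: "'n :: finite itself \<Rightarrow> nat \<Rightarrow> nat"
  where "f_max _ n = Max (num_regions ` (arrangements n :: 'n proj_space set set set))"

end

theory Submission
  imports Defs
begin

text \<open>
  Replace hyperplanes by their normal vectors. By deletion and restriction (Whitney), twice the
  number of regions of the arrangement with normals \<open>V\<close> is the sum of \<open>(-1) ^ (card S + dim S)\<close>
  over all \<open>S \<subseteq> V\<close>, and \<open>F n d = (\<Sum>j\<le>d. (n - 1) choose j)\<close> is an upper bound for the
  number of regions in dimension \<open>d\<close>.

  Arrangements whose normals span only \<open>e + 1 \<le> d + 1\<close> dimensions have the regions of an
  arrangement in \<open>RP\<^sup>e\<close>, so it suffices to fill \<open>(F n (e - 1), F n e]\<close> for \<open>3 \<le> e \<le> d\<close>
  and \<open>[sqrt (2 n) n, F n 2]\<close> for \<open>e = 2\<close>.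

  For \<open>e \<ge> 3\<close> take \<open>N = n - k\<close> hyperplanes through a common point and \<open>k\<close> others. Let groups
  of sizes \<open>p\<^sub>1, p\<^sub>2, \<dots>\<close> among the first ones have a common line, groups of sizes
  \<open>m\<^sub>1, m\<^sub>2, \<dots>\<close> among the others a common point, and let everything else be generic. This lowers
  the generic number \<open>F n e\<close> by \<open>(N - 1 choose e) + (k + 1) x + z\<close>, where \<open>x\<close> is the sum of the
  \<open>p\<^sub>i - 1 choose (e - 1)\<close> and \<open>z\<close> the sum of the \<open>m\<^sub>i - 1 choose e\<close>. Choosing the sizes greedily
  represents \<open>x\<close> and \<open>z\<close> with groups of total size \<open>O(x powr (1 / (e - 1)))\<close> and
  \<open>O(z powr (1 / e))\<close>, and with \<open>x\<close> and \<open>z\<close> as quotient and remainder modulo \<open>k + 1\<close>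
  every required defect occurs for a suitable \<open>k\<close>.

  For \<open>e = 2\<close> take \<open>n - k\<close> lines through a point and \<open>k\<close> generic lines, and let \<open>j\<close> lines of the
  pencil pass through intersection points of the generic ones. This gives
  \<open>(n - k) (k + 1) + (k choose 2) - j\<close> regions for \<open>j \<le> min (n - k) (k choose 2)\<close>, which
  leaves no gaps once \<open>k choose 2 \<ge> n - k - 2\<close>, i.e. from about \<open>k = sqrt (2 n)\<close> on.
\<close>

section \<open>Sign vectors and Whitney's formula\<close>

text \<open>A component of the complement of the hyperplanes orthogonal to \<open>V\<close> is an
  intersection of open half-spaces, so the set of vectors that are positive on it identifies it. The
  parameter \<open>W\<close> allows restriction to a hyperplane without changing the ambient
  type.\<close>

definition sign_regions :: "'a::euclidean_space set \<Rightarrow> 'a set \<Rightarrow> 'a set set"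
  where "sign_regions V W = (\<lambda>x. {v \<in> V. v \<bullet> x > 0}) ` {x \<in> W. \<forall>v\<in>V. v \<bullet> x \<noteq> 0}"

lemma sign_regions_subset_Pow: "sign_regions V W \<subseteq> Pow V"
  unfolding sign_regions_def by auto

lemma finite_sign_regions: "finite V \<Longrightarrow> finite (sign_regions V W)"
  using finite_subset[OF sign_regions_subset_Pow] by blast

lemma sign_regions_perturb:
  fixes V :: "'a::euclidean_space set"
  assumes "finite V" "\<forall>v\<in>V. v \<bullet> x \<noteq> 0"
  shows "\<exists>e>0. \<forall>v\<in>V. v \<bullet> (x + e *\<^sub>R w) \<noteq> 0 \<and> (v \<bullet> (x + e *\<^sub>R w) > 0 \<longleftrightarrow> v \<bullet> x > 0)"
proof -
  have "\<forall>\<^sub>F e in at_right (0::real). v \<bullet> (x + e *\<^sub>R w) \<noteq> 0 \<and> (v \<bullet> (x + e *\<^sub>R w) > 0 \<longleftrightarrow> v \<bullet> x > 0)"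
    if "v \<in> V" for v
  proof -
    have lim: "((\<lambda>e. v \<bullet> (x + e *\<^sub>R w)) \<longlongrightarrow> v \<bullet> (x + 0 *\<^sub>R w)) (at_right (0::real))"
      by (intro tendsto_intros)
    show ?thesis
    proof (cases "v \<bullet> x > 0")
      case True
      then have "\<forall>\<^sub>F e in at_right (0::real). v \<bullet> (x + e *\<^sub>R w) > 0"
        using order_tendstoD(1)[OF lim] by simp
      then show ?thesis by eventually_elim (use True in auto)
    next
      case False
      then have "v \<bullet> x < 0" using assms(2) that by fastforce
      then have "\<forall>\<^sub>F e in at_right (0::real). v \<bullet> (x + e *\<^sub>R w) < 0"
        using order_tendstoD(2)[OF lim] by simp
      then show ?thesis by eventually_elim (use False in auto)
    qed
  qed
  then have "\<forall>\<^sub>F e in at_right (0::real). \<forall>v\<in>V. v \<bullet> (x + e *\<^sub>R w) \<noteq> 0 \<and> (v \<bullet> (x + e *\<^sub>R w) > 0 \<longleftrightarrow> v \<bullet> x > 0)"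
    using assms(1) by (simp add: eventually_ball_finite)
  then have "\<forall>\<^sub>F e in at_right (0::real). e > 0 \<and> (\<forall>v\<in>V. v \<bullet> (x + e *\<^sub>R w) \<noteq> 0 \<and> (v \<bullet> (x + e *\<^sub>R w) > 0 \<longleftrightarrow> v \<bullet> x > 0))"
    using eventually_at_right_less[of "0::real"] by eventually_elim auto
  then show ?thesis
    using eventually_happens'[OF trivial_limit_at_right_real] by blast
qed

text \<open>Deletion and restriction. \<open>P\<close> and \<open>N\<close> collect the old regions
  that have points on the positive and on the negative side of \<open>v\<close>. Every old region is
  in \<open>P\<close> or \<open>N\<close>, and those in both are cut in two by \<open>v\<close>; by
  convexity these are the regions of the restriction to \<open>v = 0\<close>.\<close>

lemma card_sign_regions_insert:
  fixes V W :: "'a::euclidean_space set"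
  assumes V: "finite V" "v \<notin> V" and W: "subspace W" and vW: "\<exists>w\<in>W. v \<bullet> w \<noteq> 0"
  shows "card (sign_regions (insert v V) W)
    = card (sign_regions V W) + card (sign_regions V {x \<in> W. v \<bullet> x = 0})"
proof -
  define S where "S x = {u \<in> V. u \<bullet> x > 0}" for x
  define P where "P = S ` {x \<in> W. v \<bullet> x > 0 \<and> (\<forall>u\<in>V. u \<bullet> x \<noteq> 0)}"
  define N where "N = S ` {x \<in> W. v \<bullet> x < 0 \<and> (\<forall>u\<in>V. u \<bullet> x \<noteq> 0)}"
  obtain w0 where w0: "w0 \<in> W" "v \<bullet> w0 \<noteq> 0" using vW by blast
  obtain w where w: "w \<in> W" "v \<bullet> w > 0"
  proof (cases "v \<bullet> w0 > 0")
    case True then show ?thesis using w0 that by blast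
  next
    case False
    then have "v \<bullet> (- w0) > 0" using w0 by simp
    then show ?thesis using w0 W that subspace_neg by blast
  qed
  have fin: "finite P" "finite N"
    unfolding P_def N_def S_def by (auto intro: finite_subset[OF _ finite_Pow_iff[THEN iffD2, OF V(1)]])
  have insP: "insert v T \<in> sign_regions (insert v V) W \<longleftrightarrow> T \<in> P" if "T \<subseteq> V" for T
  proof
    assume "insert v T \<in> sign_regions (insert v V) W"
    then obtain x where x: "x \<in> W" "\<forall>u\<in>insert v V. u \<bullet> x \<noteq> 0" "insert v T = {u \<in> insert v V. u \<bullet> x > 0}"
      unfolding sign_regions_def by auto
    then have "T = S x" "v \<bullet> x > 0" using that V(2) unfolding S_def by auto
    with x show "T \<in> P" unfolding P_def by auto
  next
    assume "T \<in> P"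
    then obtain x where x: "x \<in> W" "v \<bullet> x > 0" "\<forall>u\<in>V. u \<bullet> x \<noteq> 0" "T = S x" unfolding P_def by auto
    then have "insert v T = {u \<in> insert v V. u \<bullet> x > 0}" unfolding S_def by auto
    then show "insert v T \<in> sign_regions (insert v V) W"
      unfolding sign_regions_def using x by (intro image_eqI[of _ _ x]) auto
  qed
  have insN: "T \<in> sign_regions (insert v V) W \<longleftrightarrow> T \<in> N" if "T \<subseteq> V" for T
  proof
    assume "T \<in> sign_regions (insert v V) W"
    then obtain x where x: "x \<in> W" "\<forall>u\<in>insert v V. u \<bullet> x \<noteq> 0" "T = {u \<in> insert v V. u \<bullet> x > 0}"
      unfolding sign_regions_def by auto
    then have "\<not> v \<bullet> x > 0" using that V(2) by auto
    then have "T = S x" "v \<bullet> x < 0" using x that V(2) unfolding S_def by (auto simp: less_le)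
    with x show "T \<in> N" unfolding N_def by auto
  next
    assume "T \<in> N"
    then obtain x where x: "x \<in> W" "v \<bullet> x < 0" "\<forall>u\<in>V. u \<bullet> x \<noteq> 0" "T = S x" unfolding N_def by auto
    then have "T = {u \<in> insert v V. u \<bullet> x > 0}" unfolding S_def by auto
    then show "T \<in> sign_regions (insert v V) W"
      unfolding sign_regions_def using x by (intro image_eqI[of _ _ x]) auto
  qed
  have PV: "P \<subseteq> Pow V" "N \<subseteq> Pow V" unfolding P_def N_def S_def by auto
  have eq: "sign_regions (insert v V) W = insert v ` P \<union> N"
  proof (rule set_eqI)
    fix T
    show "T \<in> sign_regions (insert v V) W \<longleftrightarrow> T \<in> insert v ` P \<union> N"
    proof (cases "v \<in> T")
      case True
      show ?thesis
      proof (cases "T \<subseteq> insert v V")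
        case T: True
        have "T = insert v (T - {v})" "T - {v} \<subseteq> V" using True T by auto
        then have "T \<in> sign_regions (insert v V) W \<longleftrightarrow> T - {v} \<in> P" using insP by metis
        moreover have "T \<in> insert v ` P \<longleftrightarrow> T - {v} \<in> P"
        proof
          assume "T \<in> insert v ` P"
          then obtain T' where "T = insert v T'" "T' \<in> P" by auto
          moreover have "v \<notin> T'" using PV V \<open>T' \<in> P\<close> by auto
          ultimately show "T - {v} \<in> P" by simp
        next
          assume "T - {v} \<in> P"
          then show "T \<in> insert v ` P" using True by (metis image_eqI insert_Diff)
        qed
        moreover have "T \<notin> N" using PV V True by auto
        ultimately show ?thesis by simp
      next
        case False
        then show ?thesis using sign_regions_subset_Pow[of "insert v V" W] PV by auto
      qed
    next
      case False
      show ?thesis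
      proof (cases "T \<subseteq> V")
        case True
        then show ?thesis using insN[OF True] False by auto
      next
        case F: False
        then have "\<not> T \<subseteq> insert v V" using False by auto
        then show ?thesis using sign_regions_subset_Pow[of "insert v V" W] PV by auto
      qed
    qed
  qed
  have "card (sign_regions (insert v V) W) = card (insert v ` P) + card N"
    unfolding eq using fin PV V(2) by (intro card_Un_disjoint) auto
  also have "card (insert v ` P) = card P"
    using PV V(2) by (intro card_image inj_onI) (metis PowD insert_ident subset_iff)
  also have "card P + card N = card (P \<union> N) + card (P \<inter> N)"
    using card_Un_Int[OF fin] .
  \<comment> \<open>If the chosen point of a region lies on \<open>v = 0\<close>, a small move along
    \<open>w\<close> brings it to the positive side without changing the other signs.\<close>
  also have "P \<union> N = sign_regions V W"
  proof
    show "P \<union> N \<subseteq> sign_regions V W" unfolding P_def N_def S_def sign_regions_def by auto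
    show "sign_regions V W \<subseteq> P \<union> N"
    proof
      fix T assume "T \<in> sign_regions V W"
      then obtain x where x: "x \<in> W" "\<forall>u\<in>V. u \<bullet> x \<noteq> 0" "T = S x" unfolding sign_regions_def S_def by auto
      show "T \<in> P \<union> N"
      proof (cases "v \<bullet> x = 0")
        case False
        then show ?thesis using x unfolding P_def N_def by (cases "v \<bullet> x > 0") auto
      next
        case True
        obtain e where e: "e > 0" "\<forall>u\<in>V. u \<bullet> (x + e *\<^sub>R w) \<noteq> 0 \<and> (u \<bullet> (x + e *\<^sub>R w) > 0 \<longleftrightarrow> u \<bullet> x > 0)"
          using sign_regions_perturb[OF V(1) x(2), of w] by blast
        have "x + e *\<^sub>R w \<in> W" using W x w by (simp add: subspace_add subspace_scale)
        moreover have "v \<bullet> (x + e *\<^sub>R w) > 0" using True e w by (simp add: inner_add_right)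
        moreover have "S (x + e *\<^sub>R w) = T" using e x unfolding S_def by auto
        ultimately have "T \<in> P" unfolding P_def using e by (intro image_eqI[of _ _ "x + e *\<^sub>R w"]) auto
        then show ?thesis by simp
      qed
    qed
  qed
  also have "P \<inter> N = sign_regions V {x \<in> W. v \<bullet> x = 0}"
  proof
    show "P \<inter> N \<subseteq> sign_regions V {x \<in> W. v \<bullet> x = 0}"
    proof
      fix T assume "T \<in> P \<inter> N"
      then obtain x y where x: "x \<in> W" "v \<bullet> x > 0" "\<forall>u\<in>V. u \<bullet> x \<noteq> 0" "T = S x"
        and y: "y \<in> W" "v \<bullet> y < 0" "\<forall>u\<in>V. u \<bullet> y \<noteq> 0" "T = S y" unfolding P_def N_def by auto
      \<comment> \<open>A positive combination of \<open>x\<close> and \<open>y\<close>,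
        proportional to the point where the segment between them crosses \<open>v = 0\<close>. All
        \<open>u\<close> have the same sign at \<open>x\<close> and \<open>y\<close>, hence also at
        \<open>z\<close>.\<close>
      define z where "z = (v \<bullet> x) *\<^sub>R y + (- (v \<bullet> y)) *\<^sub>R x"
      have z: "z \<in> W" "v \<bullet> z = 0"
        unfolding z_def using W x y by (auto simp: subspace_add subspace_diff subspace_scale inner_diff_right)
      have "u \<bullet> z \<noteq> 0 \<and> (u \<bullet> z > 0 \<longleftrightarrow> u \<bullet> x > 0)" if "u \<in> V" for u
      proof -
        have xy: "u \<bullet> x > 0 \<longleftrightarrow> u \<bullet> y > 0" using x y that unfolding S_def by blast
        have uz: "u \<bullet> z = (v \<bullet> x) * (u \<bullet> y) + (- (v \<bullet> y)) * (u \<bullet> x)"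
          unfolding z_def by (simp add: inner_diff_right)
        show ?thesis
        proof (cases "u \<bullet> x > 0")
          case True
          then have "u \<bullet> z > 0" unfolding uz using xy x(2) y(2) by (intro add_pos_pos mult_pos_pos) auto
          then show ?thesis using True by simp
        next
          case False
          then have "u \<bullet> x < 0" "u \<bullet> y < 0" using xy x(3) y(3) that by (auto simp: less_le not_less)
          then have "u \<bullet> z < 0" unfolding uz using x(2) y(2) by (intro add_neg_neg mult_pos_neg) auto
          then show ?thesis using False by simp
        qed
      qed
      then have "T = {u \<in> V. u \<bullet> z > 0}" "\<forall>u\<in>V. u \<bullet> z \<noteq> 0" using x unfolding S_def by auto
      then show "T \<in> sign_regions V {x \<in> W. v \<bullet> x = 0}" unfolding sign_regions_def using z by auto
    qed
    show "sign_regions V {x \<in> W. v \<bullet> x = 0} \<subseteq> P \<inter> N"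
    proof
      fix T assume "T \<in> sign_regions V {x \<in> W. v \<bullet> x = 0}"
      then obtain x where x: "x \<in> W" "v \<bullet> x = 0" "\<forall>u\<in>V. u \<bullet> x \<noteq> 0" "T = S x"
        unfolding sign_regions_def S_def by auto
      obtain e where e: "e > 0" "\<forall>u\<in>V. u \<bullet> (x + e *\<^sub>R w) \<noteq> 0 \<and> (u \<bullet> (x + e *\<^sub>R w) > 0 \<longleftrightarrow> u \<bullet> x > 0)"
        using sign_regions_perturb[OF V(1) x(3), of w] by blast
      obtain e' where e': "e' > 0" "\<forall>u\<in>V. u \<bullet> (x + e' *\<^sub>R (- w)) \<noteq> 0 \<and> (u \<bullet> (x + e' *\<^sub>R (- w)) > 0 \<longleftrightarrow> u \<bullet> x > 0)"
        using sign_regions_perturb[OF V(1) x(3), of "- w"] by blast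
      have "x + e *\<^sub>R w \<in> W" "x + e' *\<^sub>R (- w) \<in> W"
        using W x w by (auto simp: subspace_add subspace_diff subspace_scale)
      moreover have "v \<bullet> (x + e *\<^sub>R w) > 0" "v \<bullet> (x + e' *\<^sub>R (- w)) < 0"
        using x e e' w by (auto simp: inner_add_right inner_diff_right)
      moreover have "S (x + e *\<^sub>R w) = T" "S (x + e' *\<^sub>R (- w)) = T" using e e' x unfolding S_def by auto
      ultimately have "T \<in> P" "T \<in> N" unfolding P_def N_def using e e'
        by (auto intro: image_eqI[of _ _ "x + e *\<^sub>R w"] image_eqI[of _ _ "x + e' *\<^sub>R (- w)"])
      then show "T \<in> P \<inter> N" by simp
    qed
  qed
  finally show ?thesis .
qed

lemma sign_regions_empty: "subspace W \<Longrightarrow> card (sign_regions {} W) = 1"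
proof -
  assume "subspace W"
  then have "sign_regions {} W = {{}}"
    unfolding sign_regions_def using subspace_0[of W] by auto
  then show ?thesis by simp
qed

lemma sign_regions_insert_orthogonal:
  assumes "\<forall>w\<in>W. v \<bullet> w = 0"
  shows "sign_regions (insert v V) W = {}"
  using assms unfolding sign_regions_def by auto

lemma subspace_orth: "subspace W \<Longrightarrow> subspace {x \<in> W. \<forall>v\<in>S. v \<bullet> x = 0}"
  by (auto simp: subspace_def inner_add_right)

lemma subspace_orth1: "subspace W \<Longrightarrow> subspace {x \<in> W. v \<bullet> x = 0}"
  using subspace_orth[of W "{v}"] by simp

lemma dim_orth1:
  fixes W :: "'a::euclidean_space set"
  assumes W: "subspace W" and vW: "\<exists>w\<in>W. v \<bullet> w \<noteq> 0"
  shows "dim W = Suc (dim {x \<in> W. v \<bullet> x = 0})"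
proof -
  let ?K = "{x \<in> W. v \<bullet> x = 0}"
  obtain w where w: "w \<in> W" "v \<bullet> w \<noteq> 0" using vW by blast
  have sK: "subspace ?K" using subspace_orth1 W by blast
  have "W \<subseteq> span (insert w ?K)"
  proof
    fix x assume x: "x \<in> W"
    have "x - ((v \<bullet> x) / (v \<bullet> w)) *\<^sub>R w \<in> ?K"
      using W x w by (auto simp: subspace_diff subspace_scale inner_diff_right)
    then have "x - ((v \<bullet> x) / (v \<bullet> w)) *\<^sub>R w \<in> span ?K" by (rule span_base)
    then show "x \<in> span (insert w ?K)" using span_breakdown_eq by blast
  qed
  moreover have "span (insert w ?K) \<subseteq> W" using w W by (intro span_minimal) auto
  ultimately have "W = span (insert w ?K)" by (rule subset_antisym)
  then have dimW: "dim W = dim (insert w ?K)" using dim_span[of "insert w ?K"] by argo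
  have "span ?K = ?K" by (rule span_eq_iff[THEN iffD2, OF sK])
  then have "w \<notin> span ?K" using w(2) by blast
  then have "dim (insert w ?K) = Suc (dim ?K)" using dim_insert[of w ?K] Suc_eq_plus1 by presburger
  then show ?thesis using dimW by argo
qed

lemma sum_Pow_insert:
  fixes \<phi> :: "'a set \<Rightarrow> 'b::comm_monoid_add"
  assumes "finite V" "v \<notin> V"
  shows "(\<Sum>S\<in>Pow (insert v V). \<phi> S) = (\<Sum>S\<in>Pow V. \<phi> S + \<phi> (insert v S))"
proof -
  have inj: "inj_on (insert v) (Pow V)"
    using assms(2) by (intro inj_onI) (metis PowD insert_ident subset_iff)
  have "(\<Sum>S\<in>Pow (insert v V). \<phi> S) = (\<Sum>S\<in>Pow V. \<phi> S) + (\<Sum>S\<in>insert v ` Pow V. \<phi> S)"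
    unfolding Pow_insert using assms by (intro sum.union_disjoint) auto
  also have "(\<Sum>S\<in>insert v ` Pow V. \<phi> S) = (\<Sum>S\<in>Pow V. \<phi> (insert v S))"
    using inj by (simp add: sum.reindex)
  finally show ?thesis by (simp add: sum.distrib)
qed

lemma sum_minus_one_card_Pow:
  assumes "finite V" "V \<noteq> {}"
  shows "(\<Sum>S\<in>Pow V. (-1::int) ^ card S) = 0"
proof -
  obtain v V' where V': "V = insert v V'" "v \<notin> V'" using assms(2) by (meson ex_in_conv Set.set_insert)
  have f: "finite V'" using assms V' by simp
  have "(\<Sum>S\<in>Pow V. (-1::int) ^ card S) = (\<Sum>S\<in>Pow V'. (-1) ^ card S + (-1) ^ card (insert v S))"
    unfolding V'(1) by (rule sum_Pow_insert[OF f V'(2)])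
  also have "\<dots> = 0"
  proof (rule sum.neutral, rule ballI)
    fix S assume "S \<in> Pow V'"
    then have "v \<notin> S" "finite S" using V' f finite_subset by auto
    then show "(-1::int) ^ card S + (-1) ^ card (insert v S) = 0" by simp
  qed
  finally show ?thesis .
qed

lemma subspace_hyperplane2: "subspace {x. x \<bullet> y = 0}"
  by (simp add: subspace_def inner_add_left)

lemma minus_one_power_cancel: "(-1::int) ^ (c + (a + b) + a) = (-1) ^ (c + b)"
proof -
  have "c + (a + b) + a = (c + b) + 2 * a" by simp
  then show ?thesis by (simp only: power_add power_mult) simp
qed

text \<open>The exponent has the parity of \<open>card S\<close> minus the rank of \<open>S\<close> on \<open>W\<close>.\<close>

lemma whitney_restricted:
  fixes V W :: "'a::euclidean_space set"
  assumes "finite V" "subspace W"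
  shows "int (card (sign_regions V W))
    = (\<Sum>S\<in>Pow V. (-1) ^ (card S + dim W + dim {x \<in> W. \<forall>v\<in>S. v \<bullet> x = 0}))"
  using assms
proof (induction V arbitrary: W rule: finite_induct)
  case empty
  then show ?case using sign_regions_empty[of W] minus_one_power_cancel[of 0 "dim W" 0] by simp
next
  case (insert v V)
  let ?K = "\<lambda>W S. {x \<in> W. \<forall>v\<in>S. v \<bullet> x = 0}"
  let ?W' = "{x \<in> W. v \<bullet> x = 0}"
  have split: "(\<Sum>S\<in>Pow (insert v V). (-1::int) ^ (card S + dim W + dim (?K W S)))
    = (\<Sum>S\<in>Pow V. (-1) ^ (card S + dim W + dim (?K W S)) - (-1) ^ (card S + dim W + dim (?K ?W' S)))"
  proof (subst sum_Pow_insert[OF insert.hyps], rule sum.cong[OF refl])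
    fix S assume "S \<in> Pow V"
    then have "finite S" "v \<notin> S" using insert.hyps finite_subset by auto
    moreover have "?K W (insert v S) = ?K ?W' S" by auto
    ultimately show "(-1::int) ^ (card S + dim W + dim (?K W S))
        + (-1) ^ (card (insert v S) + dim W + dim (?K W (insert v S)))
      = (-1) ^ (card S + dim W + dim (?K W S)) - (-1) ^ (card S + dim W + dim (?K ?W' S))"
      by simp
  qed
  show ?case
  proof (cases "\<exists>w\<in>W. v \<bullet> w \<noteq> 0")
    case False
    then have "sign_regions (insert v V) W = {}" by (intro sign_regions_insert_orthogonal) auto
    \<comment> \<open>Restricting to \<open>?W'\<close> changes nothing, so the right-hand side
      cancels term by term, as it must when no point of \<open>W\<close> avoids
      \<open>v\<close>.\<close>
    moreover have "?W' = W" using False by auto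
    ultimately show ?thesis unfolding split by simp
  next
    case True
    have "int (card (sign_regions (insert v V) W))
        = int (card (sign_regions V W)) + int (card (sign_regions V ?W'))"
      using card_sign_regions_insert[OF insert.hyps insert.prems True] by simp
    also have "\<dots> = (\<Sum>S\<in>Pow V. (-1) ^ (card S + dim W + dim (?K W S)))
        + (\<Sum>S\<in>Pow V. (-1) ^ (card S + dim ?W' + dim (?K ?W' S)))"
      using insert.IH[OF insert.prems] insert.IH[OF subspace_orth1[OF insert.prems]] by simp
    \<comment> \<open>The restriction has dimension one less than \<open>W\<close>, which turns the
      plus sign of the recursion into the minus sign of \<open>split\<close>.\<close>
    also have "\<dots> = (\<Sum>S\<in>Pow V. (-1) ^ (card S + dim W + dim (?K W S))
        - (-1) ^ (card S + dim W + dim (?K ?W' S)))"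
      unfolding sum.distrib[symmetric] dim_orth1[OF insert.prems True]
      by (intro sum.cong) (auto simp: power_add)
    finally show ?thesis unfolding split .
  qed
qed

text \<open>For \<open>W = UNIV\<close> the common zero set of \<open>S\<close> has codimension
  \<open>dim S\<close>, so the exponent simplifies by parity.\<close>

lemma whitney:
  fixes V :: "'a::euclidean_space set"
  assumes "finite V"
  shows "int (card (sign_regions V UNIV)) = (\<Sum>S\<in>Pow V. (-1) ^ (card S + dim S))"
proof -
  have "(-1::int) ^ (card S + dim (UNIV::'a set) + dim {x \<in> UNIV. \<forall>v\<in>S. v \<bullet> x = 0}) = (-1) ^ (card S + dim S)"
    for S :: "'a set"
  proof -
    have "dim {y \<in> UNIV. \<forall>x\<in>span S. orthogonal x y} + dim (span S) = dim (UNIV::'a set)"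
      by (rule dim_subspace_orthogonal_to_vectors) auto
    moreover have "{y \<in> UNIV. \<forall>x\<in>span S. orthogonal x y} = {y \<in> UNIV. \<forall>x\<in>S. x \<bullet> y = 0}"
    proof -
      have "(\<forall>x\<in>span S. orthogonal x y) \<longleftrightarrow> (\<forall>x\<in>S. x \<bullet> y = 0)" for y
      proof
        assume "\<forall>x\<in>S. x \<bullet> y = 0"
        then have "span S \<subseteq> {x. x \<bullet> y = 0}" by (intro span_minimal) (auto simp: subspace_hyperplane2)
        then show "\<forall>x\<in>span S. orthogonal x y" by (auto simp: orthogonal_def)
      qed (auto simp: orthogonal_def span_base)
      then show ?thesis by simp
    qed
    ultimately have "dim (UNIV::'a set) = dim {x \<in> UNIV. \<forall>v\<in>S. v \<bullet> x = 0} + dim S"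
      unfolding dim_span by argo
    then show ?thesis by (simp only: minus_one_power_cancel)
  qed
  then show ?thesis
    unfolding whitney_restricted[OF assms subspace_UNIV] by (intro sum.cong refl)
qed

section \<open>The upper bound for the number of regions\<close>

text \<open>Pascal's rule summed over \<open>i\<close>: the same recursion as deletion and
  restriction, with \<open>w\<close> as the dimension of the restricted space.\<close>

lemma choose_sum_step:
  "(\<Sum>i<Suc w. Suc n choose i) = (\<Sum>i<Suc w. n choose i) + (\<Sum>i<w. n choose i)"
  by (induction w) auto

text \<open>Deletion and restriction give at most the recursion \<open>choose_sum_step\<close>. The
  factor 2 starts with a single vector, which has two sides.\<close>

lemma card_sign_regions_le:
  fixes V W :: "'a::euclidean_space set"
  assumes "finite V" "subspace W" "V \<noteq> {}"
  shows "card (sign_regions V W) \<le> 2 * (\<Sum>i<dim W. (card V - 1) choose i)"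
  using assms
proof (induction V arbitrary: W rule: finite_induct)
  case (insert v V)
  let ?W' = "{x \<in> W. v \<bullet> x = 0}"
  show ?case
  proof (cases "\<exists>w\<in>W. v \<bullet> w \<noteq> 0")
    case False
    then have "sign_regions (insert v V) W = {}" by (intro sign_regions_insert_orthogonal) auto
    then show ?thesis by simp
  next
    case True
    note rec = card_sign_regions_insert[OF insert.hyps insert.prems(1) True]
    note d = dim_orth1[OF insert.prems(1) True]
    show ?thesis
    proof (cases "V = {}")
      case True
      have "(\<Sum>i<Suc w. 0 choose i) = (1::nat)" for w by (simp add: sum.lessThan_Suc_shift del: sum.lessThan_Suc)
      then show ?thesis
        using rec sign_regions_empty[OF insert.prems(1)] sign_regions_empty[OF subspace_orth1[OF insert.prems(1)]]
        by (simp add: True d)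
    next
      case False
      then obtain m where m: "card V = Suc m" using insert.hyps by (metis card_eq_0_iff not0_implies_Suc)
      have "card (sign_regions V W) \<le> 2 * (\<Sum>i<dim W. m choose i)"
        using insert.IH[OF insert.prems(1) False] m by simp
      moreover have "card (sign_regions V ?W') \<le> 2 * (\<Sum>i<dim ?W'. m choose i)"
        using insert.IH[OF subspace_orth1[OF insert.prems(1)] False] m by simp
      ultimately show ?thesis
        unfolding rec d using insert.hyps m choose_sum_step[of m "dim ?W'"] by (simp del: sum.lessThan_Suc)
    qed
  qed
qed simp

section \<open>Regions of projective arrangements\<close>

definition normal_hyperplane :: "real ^ 'n \<Rightarrow> 'n :: finite proj_space set"
  where "normal_hyperplane v = {p. line_of p \<subseteq> {x. v \<bullet> x = 0}}"

lemma proj_point_in_normal_hyperplane: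
  assumes "x \<noteq> 0"
  shows "proj_point x \<in> normal_hyperplane v \<longleftrightarrow> v \<bullet> x = 0"
proof -
  have "span {x} \<subseteq> {y. v \<bullet> y = 0} \<longleftrightarrow> v \<bullet> x = 0"
  proof
    assume "span {x} \<subseteq> {y. v \<bullet> y = 0}"
    then show "v \<bullet> x = 0" using span_base[of x "{x}"] by auto
  next
    assume "v \<bullet> x = 0"
    then show "span {x} \<subseteq> {y. v \<bullet> y = 0}"
      by (intro span_minimal) (auto simp: subspace_hyperplane)
  qed
  then show ?thesis unfolding normal_hyperplane_def using line_of_proj_point[OF assms] by simp
qed

lemma proj_point_eq_iff:
  fixes x y :: "real ^ 'n :: finite"
  assumes "x \<noteq> 0" "y \<noteq> 0"
  shows "proj_point x = proj_point y \<longleftrightarrow> (\<exists>c. c \<noteq> 0 \<and> y = c *\<^sub>R x)"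
proof
  assume "proj_point x = proj_point y"
  then have "span {x} = span {y}" using line_of_proj_point assms by metis
  then have "y \<in> span {x}" using span_base[of y "{y}"] by simp
  then obtain c where "y = c *\<^sub>R x" by (auto simp: span_singleton)
  then show "\<exists>c. c \<noteq> 0 \<and> y = c *\<^sub>R x" using assms by auto
next
  assume "\<exists>c. c \<noteq> 0 \<and> y = c *\<^sub>R x"
  then obtain c where c: "c \<noteq> 0" "y = c *\<^sub>R x" by blast
  then have xy: "x = (1 / c) *\<^sub>R y" by simp
  have "span {x} \<subseteq> span {y}"
    by (subst xy, rule span_minimal) (auto simp: span_base span_scale)
  moreover have "span {y} \<subseteq> span {x}" unfolding c(2) by (rule span_minimal) (auto simp: span_base span_scale)
  ultimately show "proj_point x = proj_point y" unfolding proj_point_def by simp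
qed

lemma proj_hyperplane_normal_hyperplane:
  fixes v :: "real ^ 'n :: finite"
  assumes "v \<noteq> 0"
  shows "proj_hyperplane (normal_hyperplane v)"
  unfolding proj_hyperplane_def normal_hyperplane_def
  using assms by (intro exI[of _ "{x. v \<bullet> x = 0}"]) (simp add: subspace_hyperplane dim_hyperplane)

lemma proj_hyperplane_normalE:
  assumes "proj_hyperplane (H :: 'n :: finite proj_space set)"
  obtains v where "v \<noteq> 0" "H = normal_hyperplane v"
proof -
  obtain W :: "(real ^ 'n) set" where W: "subspace W" "dim W = CARD('n) - 1" "H = {p. line_of p \<subseteq> W}"
    using assms unfolding proj_hyperplane_def by blast
  have "dim W < DIM(real ^ 'n)" using W(2) by (simp add: zero_less_card_finite)
  then obtain v where v: "v \<noteq> 0" "span W \<subseteq> {x. v \<bullet> x = 0}" using lowdim_subset_hyperplane by metis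
  have "W = {x. v \<bullet> x = 0}"
    using W v span_superset[of W] by (intro subspace_dim_equal) (auto simp: subspace_hyperplane dim_hyperplane)
  then show thesis using that[of v] v W(3) unfolding normal_hyperplane_def by simp
qed

text \<open>The component \<open>w\<close> of \<open>u\<close> orthogonal to \<open>v\<close> lies
  in the hyperplane of \<open>v\<close>, hence in that of \<open>u\<close>, so it is orthogonal to
  itself and vanishes. This is what makes pairwise non-parallel normals give distinct
  hyperplanes.\<close>

lemma normal_hyperplane_eq_imp_span:
  fixes u v :: "real ^ 'n :: finite"
  assumes "v \<noteq> 0" "normal_hyperplane u = normal_hyperplane v"
  shows "u \<in> span {v}"
proof -
  have zero: "u \<bullet> x = 0" if "v \<bullet> x = 0" for x
    using that assms(2) proj_point_in_normal_hyperplane[of x] by (cases "x = 0") auto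
  define w where "w = u - ((v \<bullet> u) / (v \<bullet> v)) *\<^sub>R v"
  have "v \<bullet> w = 0" unfolding w_def using assms(1) by (simp add: inner_diff_right)
  moreover from zero[OF this] have "u \<bullet> w = 0" .
  ultimately have "w \<bullet> w = 0" by (subst (1) w_def) (simp add: inner_diff_left)
  then have "u = ((v \<bullet> u) / (v \<bullet> v)) *\<^sub>R v" unfolding w_def by simp
  then show ?thesis by (metis span_base span_scale insertI1)
qed

text \<open>The union of all pieces other than \<open>D\<close> is open as well, so a connected
  subset of \<open>U\<close> that meets \<open>D\<close> cannot leave it.\<close>

lemma components_eq_partition:
  assumes U: "\<Union>\<D> = U"
    and D: "\<And>D. D \<in> \<D> \<Longrightarrow> open D \<and> connected D \<and> D \<noteq> {}"
    and disj: "\<And>D E. D \<in> \<D> \<Longrightarrow> E \<in> \<D> \<Longrightarrow> D \<noteq> E \<Longrightarrow> D \<inter> E = {}"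
  shows "components U = \<D>"
proof -
  have comp: "connected_component_set U p = D" if "D \<in> \<D>" "p \<in> D" for D p
  proof
    show "D \<subseteq> connected_component_set U p"
      using D[OF that(1)] that U by (intro connected_component_maximal) auto
    define K where "K = connected_component_set U p"
    have K: "connected K" "K \<subseteq> U" "p \<in> K"
      unfolding K_def using that U by (auto simp: connected_component_subset connected_component_refl)
    have "K \<subseteq> D \<union> \<Union>(\<D> - {D})" using K(2) U by auto
    moreover have "open (\<Union>(\<D> - {D}))" using D by (intro open_Union) auto
    moreover have "D \<inter> \<Union>(\<D> - {D}) \<inter> K = {}" using disj that(1) by fastforce
    ultimately have "\<Union>(\<D> - {D}) \<inter> K = {}"
      using connectedD[OF K(1), of D "\<Union>(\<D> - {D})"] D[OF that(1)] K(3) that(2) by auto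
    then show "K \<subseteq> D" using \<open>K \<subseteq> D \<union> \<Union>(\<D> - {D})\<close> by blast
  qed
  show ?thesis
  proof
    show "components U \<subseteq> \<D>" unfolding components_def using comp U by auto
    show "\<D> \<subseteq> components U"
    proof
      fix D assume "D \<in> \<D>"
      moreover obtain p where "p \<in> D" using D[OF calculation] by auto
      ultimately show "D \<in> components U" unfolding components_def using comp U by blast
    qed
  qed
qed

text \<open>The regions are the images \<open>D T\<close> of the open convex cones
  \<open>C T\<close>. Opposite cones \<open>C T\<close> and \<open>C (V - T)\<close> have the same
  image and no other coincidences occur, so the map from cones to regions is two to one.\<close>

lemma num_regions_normal_hyperplanes:
  fixes V :: "(real ^ 'n :: finite) set"
  assumes V: "finite V" "V \<noteq> {}"
  shows "2 * num_regions (normal_hyperplane ` V) = card (sign_regions V UNIV)"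
proof -
  define R where "R = sign_regions V (UNIV :: (real ^ 'n) set)"
  define C where "C T = {x. \<forall>v\<in>V. if v \<in> T then v \<bullet> x > 0 else v \<bullet> x < 0}" for T
  define D where "D T = proj_point ` C T" for T
  have nz: "x \<noteq> 0" if "x \<in> C T" for x T
    using that V(2) unfolding C_def by (auto split: if_splits)
  have R_iff: "T \<in> R \<longleftrightarrow> T \<subseteq> V \<and> C T \<noteq> {}" for T
  proof
    assume "T \<in> R"
    then obtain x where "\<forall>v\<in>V. v \<bullet> x \<noteq> 0" "T = {v \<in> V. v \<bullet> x > 0}" unfolding R_def sign_regions_def by auto
    then have "x \<in> C T" "T \<subseteq> V" unfolding C_def by (auto simp: less_le)
    then show "T \<subseteq> V \<and> C T \<noteq> {}" by auto
  next
    assume "T \<subseteq> V \<and> C T \<noteq> {}"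
    then obtain x where x: "T \<subseteq> V" "x \<in> C T" by auto
    then have "\<forall>v\<in>V. v \<bullet> x \<noteq> 0" "T = {v \<in> V. v \<bullet> x > 0}"
      unfolding C_def by (auto split: if_splits)
    then show "T \<in> R" unfolding R_def sign_regions_def by auto
  qed
  have uminus_C: "- x \<in> C (V - T)" if "x \<in> C T" for x T
    using that unfolding C_def by (auto split: if_splits)
  have C_unique: "T = T'" if "x \<in> C T" "x \<in> C T'" "T \<subseteq> V" "T' \<subseteq> V" for x T T'
  proof -
    have "v \<in> T \<longleftrightarrow> v \<in> T'" if "v \<in> V" for v
      using \<open>x \<in> C T\<close> \<open>x \<in> C T'\<close> that unfolding C_def by (auto split: if_splits dest!: bspec[of _ _ v])
    then show ?thesis using that by auto
  qed
  have C_scale: "c *\<^sub>R x \<in> C T" if "x \<in> C T" "c > 0" for c x T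
    using that unfolding C_def by (auto split: if_splits simp: mult_pos_neg)
  have convC: "convex (C T)" for T
  proof -
    have "C T = (\<Inter>v\<in>V. if v \<in> T then {x. v \<bullet> x > 0} else {x. v \<bullet> x < 0})"
      unfolding C_def by (auto split: if_splits)
    moreover have "convex (\<Inter>v\<in>V. if v \<in> T then {x. v \<bullet> x > 0} else {x. v \<bullet> x < 0})"
      by (rule convex_INT) (simp add: convex_halfspace_gt convex_halfspace_lt)
    ultimately show ?thesis by argo
  qed
  have openC: "open (C T)" for T
  proof -
    have "C T = (\<Inter>v\<in>V. if v \<in> T then {x. v \<bullet> x > 0} else {x. v \<bullet> x < 0})"
      unfolding C_def by (auto split: if_splits)
    moreover have "open (\<Inter>v\<in>V. if v \<in> T then {x. v \<bullet> x > 0} else {x. v \<bullet> x < 0})"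
      using V(1) by (intro open_INT) (auto simp: open_halfspace_gt open_halfspace_lt)
    ultimately show ?thesis by argo
  qed
  have R_compl: "V - T \<in> R" if "T \<in> R" for T
    using that uminus_C unfolding R_iff by blast
  \<comment> \<open>In the quotient topology this shows that \<open>D T\<close> is open, and it also
    determines which cones have meeting images.\<close>
  have preimage: "{x. x \<noteq> 0 \<and> proj_point x \<in> D T} = C T \<union> C (V - T)" if T: "T \<subseteq> V" for T
  proof (intro set_eqI iffI)
    fix x assume "x \<in> {x. x \<noteq> 0 \<and> proj_point x \<in> D T}"
    then obtain y where y: "x \<noteq> 0" "y \<in> C T" "proj_point y = proj_point x" unfolding D_def by auto
    then obtain c where c: "c \<noteq> 0" "x = c *\<^sub>R y" using proj_point_eq_iff nz by blast
    show "x \<in> C T \<union> C (V - T)"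
    proof (cases "c > 0")
      case True then show ?thesis using C_scale[OF y(2)] c by simp
    next
      case False
      then have "(- c) *\<^sub>R y \<in> C T" using C_scale[OF y(2), of "- c"] c by simp
      then show ?thesis using uminus_C c by force
    qed
  next
    fix x assume x: "x \<in> C T \<union> C (V - T)"
    then have x0: "x \<noteq> 0" using nz by auto
    have "proj_point x \<in> D T"
    proof (cases "x \<in> C T")
      case True then show ?thesis unfolding D_def by simp
    next
      case False
      then have "- x \<in> C (V - (V - T))" using x uminus_C by blast
      moreover have "V - (V - T) = T" using T by auto
      moreover have "proj_point x = proj_point (- x)"
        using x0 by (subst proj_point_eq_iff) (auto intro!: exI[of _ "-1"])
      ultimately show ?thesis unfolding D_def by auto
    qed
    then show "x \<in> {x. x \<noteq> 0 \<and> proj_point x \<in> D T}" using x0 by simp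
  qed
  have mem_D: "proj_point x \<in> D T \<longleftrightarrow> x \<in> C T \<or> x \<in> C (V - T)" if "T \<subseteq> V" "x \<noteq> 0" for T x
    using preimage[OF that(1)] that(2) by blast
  have DC: "D (V - T) = D T" if T: "T \<subseteq> V" for T
  proof (rule set_eqI)
    fix p :: "'n proj_space"
    obtain x where x: "x \<noteq> 0" "p = proj_point x" by (rule proj_point_surj)
    have "V - (V - T) = T" using T by auto
    then show "p \<in> D (V - T) \<longleftrightarrow> p \<in> D T"
      unfolding x(2) mem_D[OF T x(1)] mem_D[OF Diff_subset x(1)] by argo
  qed
  have D_meet: "T' = T \<or> T' = V - T" if "T \<in> R" "T' \<in> R" "D T \<inter> D T' \<noteq> {}" for T T'
  proof -
    have "D T \<inter> D T' \<noteq> {}" by (rule that(3))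
    then obtain p where p: "p \<in> D T" "p \<in> D T'" by blast
    obtain x where x: "x \<noteq> 0" "p = proj_point x" by (rule proj_point_surj)
    have sub: "T \<subseteq> V" "T' \<subseteq> V" using that R_iff by auto
    have "x \<in> C T \<or> x \<in> C (V - T)" "x \<in> C T' \<or> x \<in> C (V - T')"
      using p x(1) mem_D[OF sub(1)] mem_D[OF sub(2)] unfolding x(2) by auto
    then have "T = T' \<or> T = V - T' \<or> V - T = T' \<or> V - T = V - T'"
      using C_unique[OF _ _ sub] C_unique[OF _ _ sub(1) Diff_subset]
        C_unique[OF _ _ Diff_subset sub(2)] C_unique[OF _ _ Diff_subset Diff_subset] by blast
    then show ?thesis using sub by blast
  qed
  have Dne: "D T \<noteq> {}" if "T \<in> R" for T using that unfolding R_iff D_def by simp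
  have comp: "components (- \<Union>(normal_hyperplane ` V)) = D ` R"
  proof (rule components_eq_partition)
    show "\<Union>(D ` R) = - \<Union>(normal_hyperplane ` V)"
    proof (rule set_eqI)
      fix p :: "'n proj_space"
      obtain x where x: "x \<noteq> 0" "p = proj_point x" by (rule proj_point_surj)
      have "p \<in> - \<Union>(normal_hyperplane ` V) \<longleftrightarrow> (\<forall>v\<in>V. v \<bullet> x \<noteq> 0)"
        using x proj_point_in_normal_hyperplane by auto
      also have "\<dots> \<longleftrightarrow> p \<in> \<Union>(D ` R)"
      proof
        assume a: "\<forall>v\<in>V. v \<bullet> x \<noteq> 0"
        define T where "T = {v \<in> V. v \<bullet> x > 0}"
        have "x \<in> C T" using a unfolding C_def T_def by (auto simp: less_le)
        then have "T \<in> R" "p \<in> D T" unfolding R_iff D_def using x unfolding T_def by auto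
        then show "p \<in> \<Union>(D ` R)" by auto
      next
        assume "p \<in> \<Union>(D ` R)"
        then obtain T where T: "T \<in> R" "p \<in> D T" by auto
        then have "x \<in> C T \<union> C (V - T)" using preimage[of T] R_iff x by auto
        then have "\<exists>T. x \<in> C T" by blast
        then show "\<forall>v\<in>V. v \<bullet> x \<noteq> 0" unfolding C_def by (metis (mono_tags, lifting) less_irrefl mem_Collect_eq)
      qed
      finally show "p \<in> \<Union>(D ` R) \<longleftrightarrow> p \<in> - \<Union>(normal_hyperplane ` V)" by simp
    qed
  next
    fix E assume "E \<in> D ` R"
    then obtain T where T: "T \<in> R" "E = D T" by auto
    have "open (D T)" unfolding open_proj_space_def using preimage T R_iff openC by auto
    moreover have "connected (D T)"
    proof -
      have "continuous_on (- {0 :: real ^ 'n}) proj_point"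
        using quotient_imp_continuous_map[OF quotient_map_proj_point] by simp
      then have "continuous_on (C T) (proj_point :: real ^ 'n \<Rightarrow> _)"
        by (rule continuous_on_subset) (use nz in auto)
      then show ?thesis unfolding D_def
        by (intro connected_continuous_image convex_connected[OF convC])
    qed
    ultimately show "open E \<and> connected E \<and> E \<noteq> {}" using Dne T by simp
  next
    fix E F assume "E \<in> D ` R" "F \<in> D ` R" "E \<noteq> F"
    then obtain T T' where T: "T \<in> R" "T' \<in> R" "E = D T" "F = D T'" by blast
    show "E \<inter> F = {}"
    proof (rule ccontr)
      assume "E \<inter> F \<noteq> {}"
      then have "T' = T \<or> T' = V - T" using D_meet T by simp
      then have "D T' = D T" using DC R_iff T(1) by auto
      then show False using T \<open>E \<noteq> F\<close> by simp
    qed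
  qed
  have finR: "finite R" unfolding R_def by (rule finite_sign_regions[OF V(1)])
  \<comment> \<open>Count the cones by their images: each fibre is \<open>{T, V - T}\<close>, which
    has two elements because \<open>V\<close> is nonempty.\<close>
  have "card R = (\<Sum>E\<in>D ` R. card {T \<in> R. D T = E})"
    using sum.image_gen[OF finR, of "\<lambda>_. 1::nat" D] by (simp only: card_eq_sum)
  also have "\<dots> = (\<Sum>E\<in>D ` R. 2)"
  proof (rule sum.cong[OF refl])
    fix E assume "E \<in> D ` R"
    then obtain T where T: "T \<in> R" "E = D T" by auto
    have "{T' \<in> R. D T' = E} = {T, V - T}"
    proof (intro set_eqI iffI)
      fix T' assume "T' \<in> {T' \<in> R. D T' = E}"
      then have "T' \<in> R" "D T \<inter> D T' \<noteq> {}" using T Dne by auto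
      then show "T' \<in> {T, V - T}" using D_meet[OF T(1)] by simp
    next
      fix T' assume "T' \<in> {T, V - T}"
      then show "T' \<in> {T' \<in> R. D T' = E}" using T R_compl[OF T(1)] DC R_iff by auto
    qed
    moreover have "T \<noteq> V - T" using V(2) by auto
    ultimately show "card {T \<in> R. D T = E} = 2" by simp
  qed
  finally show ?thesis unfolding num_regions_def comp R_def by simp
qed

lemma num_regions_le:
  fixes A :: "'n :: finite proj_space set set"
  assumes "A \<in> arrangements n" "n > 0"
  shows "num_regions A \<le> (\<Sum>i<CARD('n). (n - 1) choose i)"
proof -
  have A: "finite A" "card A = n" "\<forall>H\<in>A. proj_hyperplane H" using assms unfolding arrangements_def by auto
  have "\<forall>H\<in>A. \<exists>v. H = normal_hyperplane v" using A(3) proj_hyperplane_normalE by metis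
  then obtain nv where nv: "\<And>H. H \<in> A \<Longrightarrow> H = normal_hyperplane (nv H)" by metis
  define V where "V = nv ` A"
  have AV: "A = normal_hyperplane ` V" unfolding V_def using nv by force
  have "inj_on nv A" using nv by (metis inj_onI)
  then have cV: "card V = n" "finite V" "V \<noteq> {}" unfolding V_def using A assms(2) by (auto simp: card_image)
  have "2 * num_regions A = card (sign_regions V UNIV)"
    unfolding AV by (rule num_regions_normal_hyperplanes[OF cV(2,3)])
  also have "\<dots> \<le> 2 * (\<Sum>i<CARD('n). (n - 1) choose i)"
    using card_sign_regions_le[OF cV(2) subspace_UNIV cV(3)] cV(1) by simp
  finally show ?thesis by simp
qed

section \<open>From sets of normal vectors to arrangements\<close>

text \<open>Nonzero and pairwise non-parallel: the condition under which distinct normals define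
  distinct hyperplanes.\<close>

definition simple_vectors :: "'a::real_vector set \<Rightarrow> bool"
  where "simple_vectors V \<longleftrightarrow> finite V \<and> 0 \<notin> V \<and> (\<forall>u\<in>V. \<forall>v\<in>V. u \<in> span {v} \<longrightarrow> u = v)"

text \<open>The right-hand side of Whitney's formula, hence twice the number of regions when
  \<open>V\<close> is finite and nonempty.\<close>

definition signed_rank_sum :: "'a::euclidean_space set \<Rightarrow> int"
  where "signed_rank_sum V = (\<Sum>S\<in>Pow V. (-1) ^ (card S + dim S))"

lemma arrangement_of_vectors:
  fixes V :: "(real ^ 'n :: finite) set"
  assumes V: "simple_vectors V" "V \<noteq> {}" and f: "signed_rank_sum V = 2 * f"
  shows "normal_hyperplane ` V \<in> arrangements (card V)" "int (num_regions (normal_hyperplane ` V)) = f"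
proof -
  have "inj_on normal_hyperplane V"
    using V normal_hyperplane_eq_imp_span unfolding simple_vectors_def by (metis inj_onI)
  moreover have "\<forall>H\<in>normal_hyperplane ` V. proj_hyperplane H"
  proof
    fix H assume "H \<in> normal_hyperplane ` V"
    then obtain v where v: "v \<in> V" "H = normal_hyperplane v" by blast
    then have "v \<noteq> 0" using V(1) unfolding simple_vectors_def by blast
    then show "proj_hyperplane H" unfolding v(2) by (rule proj_hyperplane_normal_hyperplane)
  qed
  ultimately show "normal_hyperplane ` V \<in> arrangements (card V)"
    unfolding arrangements_def using V(1) by (simp add: simple_vectors_def card_image)
  have "finite V" using V unfolding simple_vectors_def by simp
  then show "int (num_regions (normal_hyperplane ` V)) = f"
    using whitney[of V] num_regions_normal_hyperplanes[of V] V(2) f unfolding signed_rank_sum_def by linarith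
qed

section \<open>Adding vectors in general position\<close>

text \<open>A real vector space is not a finite union of proper subspaces; this is the source of all
  general position below.\<close>

lemma avoid_finite_subspaces:
  fixes H :: "'a::real_vector set"
  assumes "finite \<F>" "subspace H" "\<And>Y. Y \<in> \<F> \<Longrightarrow> subspace Y \<and> \<not> H \<subseteq> Y"
  shows "\<exists>v\<in>H. \<forall>Y\<in>\<F>. v \<notin> Y"
  using assms
proof (induction \<F> rule: finite_induct)
  case empty
  then show ?case using subspace_0 by blast
next
  case (insert Y \<F>)
  then obtain v where v: "v \<in> H" "\<forall>Y\<in>\<F>. v \<notin> Y" by auto
  show ?case
  proof (cases "v \<in> Y")
    case False
    then show ?thesis using v by blast
  next
    case True
    \<comment> \<open>The line of the points \<open>w + t *\<^sub>R v\<close> misses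
      \<open>Y\<close>, which contains \<open>v\<close> but not \<open>w\<close>, and meets each
      other subspace at most once, since two meetings would put \<open>v\<close> into it. Hence all
      but finitely many \<open>t\<close> work.\<close>
    obtain w where w: "w \<in> H" "w \<notin> Y" using insert.prems by blast
    have one: "t = t'" if "Z \<in> \<F>" "w + t *\<^sub>R v \<in> Z" "w + t' *\<^sub>R v \<in> Z" for t t' Z
    proof (rule ccontr)
      assume "t \<noteq> t'"
      have sZ: "subspace Z" using insert.prems that by blast
      have "(w + t *\<^sub>R v) - (w + t' *\<^sub>R v) \<in> Z" using sZ that by (blast intro: subspace_diff)
      then have "(t - t') *\<^sub>R v \<in> Z" by (simp add: algebra_simps)
      then have "(1 / (t - t')) *\<^sub>R ((t - t') *\<^sub>R v) \<in> Z" using sZ by (blast intro: subspace_scale)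
      then have "v \<in> Z" using \<open>t \<noteq> t'\<close> by simp
      then show False using v that by blast
    qed
    have "finite {t. w + t *\<^sub>R v \<in> Z}" if "Z \<in> \<F>" for Z
    proof (cases "\<exists>t. w + t *\<^sub>R v \<in> Z")
      case True
      then obtain t where "w + t *\<^sub>R v \<in> Z" by blast
      then have "{t. w + t *\<^sub>R v \<in> Z} \<subseteq> {t}" using one[OF that] by blast
      then show ?thesis using finite_subset by blast
    qed auto
    then have "finite (\<Union>Z\<in>\<F>. {t. w + t *\<^sub>R v \<in> Z})" using insert.hyps by blast
    then obtain t where t: "t \<notin> (\<Union>Z\<in>\<F>. {t. w + t *\<^sub>R v \<in> Z})"
      using ex_new_if_finite infinite_UNIV_char_0 by blast
    have sH: "subspace H" and sY: "subspace Y" using insert.prems by blast+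
    have "w + t *\<^sub>R v \<notin> Y"
    proof
      assume "w + t *\<^sub>R v \<in> Y"
      moreover have "t *\<^sub>R v \<in> Y" using True sY by (rule subspace_scale[rotated])
      ultimately have "(w + t *\<^sub>R v) - t *\<^sub>R v \<in> Y" using sY by (blast intro: subspace_diff)
      then show False using w(2) by simp
    qed
    moreover have "w + t *\<^sub>R v \<in> H" using sH v(1) w(1) by (blast intro: subspace_add subspace_scale)
    ultimately show ?thesis using t by blast
  qed
qed

text \<open>
  For \<open>v\<close> generic in \<open>H\<close>, adding \<open>v\<close> to \<open>S \<subseteq> V\<close> raises the rank unless \<open>span S\<close> already
  contains \<open>H\<close>, so the effect of \<open>v\<close> on all signed sums over subsets is determined by \<open>H\<close>.
\<close>

definition generic_in :: "'a::euclidean_space \<Rightarrow> 'a set \<Rightarrow> 'a set \<Rightarrow> bool"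
  where "generic_in v H V \<longleftrightarrow> v \<in> H \<and> (\<forall>S\<subseteq>V. v \<in> span S \<longrightarrow> H \<subseteq> span S)"

text \<open>It suffices to avoid the spans of those subsets of \<open>V\<close> whose span does not
  contain \<open>H\<close>, and these are finitely many.\<close>

lemma generic_in_exists:
  fixes H :: "'a::euclidean_space set"
  assumes "finite V" "subspace H"
  shows "\<exists>v. generic_in v H V"
proof -
  let ?F = "span ` {S \<in> Pow V. \<not> H \<subseteq> span S}"
  have "\<exists>v\<in>H. \<forall>Y\<in>?F. v \<notin> Y"
    by (rule avoid_finite_subspaces[OF _ assms(2)]) (use assms(1) in auto)
  then obtain v where v: "v \<in> H" "\<forall>Y\<in>?F. v \<notin> Y" by (elim bexE)
  have "H \<subseteq> span S" if "S \<subseteq> V" "v \<in> span S" for S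
    using bspec[OF v(2), of "span S"] that by auto
  then show ?thesis unfolding generic_in_def using v(1) by (intro exI[of _ v]) simp
qed

lemma generic_in_mono: "generic_in v H V \<Longrightarrow> V' \<subseteq> V \<Longrightarrow> generic_in v H V'"
  unfolding generic_in_def by blast

lemma generic_in_span_iff:
  "generic_in v H V \<Longrightarrow> S \<subseteq> V \<Longrightarrow> v \<in> span S \<longleftrightarrow> H \<subseteq> span S"
  unfolding generic_in_def by blast

lemma subspace_dim_le_span: "H \<subseteq> span S \<Longrightarrow> dim H \<le> dim (S::'a::euclidean_space set)"
  using dim_subset[of H "span S"] by simp

lemma generic_in_not_span_singleton:
  assumes "generic_in v H V" "dim H \<ge> 2" "u \<in> V"
  shows "v \<notin> span {u}"
proof
  assume "v \<in> span {u}"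
  then have "H \<subseteq> span {u}" using generic_in_span_iff[OF assms(1), of "{u}"] assms(3) by simp
  then have "dim H \<le> dim {u}" by (rule subspace_dim_le_span)
  then show False using assms(2) dim_le_card'[of "{u}"] by simp
qed

lemma generic_in_not_mem: "generic_in v H V \<Longrightarrow> dim H \<ge> 2 \<Longrightarrow> v \<notin> V"
  using generic_in_not_span_singleton span_base by blast

text \<open>A subspace of dimension at least 2 lies neither in \<open>{0}\<close> nor in a line, so
  a generic vector of it is nonzero and parallel to no vector of \<open>V\<close>.\<close>

lemma simple_vectors_insert_generic:
  assumes "generic_in v H V" "dim H \<ge> 2" "simple_vectors V"
  shows "simple_vectors (insert v V)"
proof -
  have v0: "v \<noteq> 0"
  proof
    assume "v = 0"
    then have "H \<subseteq> span {}" using generic_in_span_iff[OF assms(1), of "{}"] by simp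
    then have "dim H = 0" by simp
    then show False using assms(2) by linarith
  qed
  have vu: "v \<notin> span {u}" if "u \<in> V" for u using generic_in_not_span_singleton assms that by blast
  have uv: "u \<notin> span {v}" if "u \<in> V" for u
  proof
    assume "u \<in> span {v}"
    then obtain c where c: "u = c *\<^sub>R v" by (auto simp: span_singleton)
    moreover have "u \<noteq> 0" using that assms(3) unfolding simple_vectors_def by blast
    ultimately have "v = (1 / c) *\<^sub>R u" by auto
    then have "v \<in> span {u}" by (metis insertI1 span_base span_scale)
    then show False using vu that by blast
  qed
  show ?thesis
    using assms(3) v0 vu uv unfolding simple_vectors_def by auto
qed

section \<open>Whitney numbers under insertion of a generic vector\<close>

text \<open>The Whitney numbers of the first kind with their alternating sign removed, that is, the
  coefficients of the characteristic polynomial up to sign. Summed over all \<open>j\<close> they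
  give \<open>signed_rank_sum\<close>.\<close>

definition whitney_num :: "nat \<Rightarrow> 'a::euclidean_space set \<Rightarrow> int"
  where "whitney_num j V = (\<Sum>S\<in>Pow V. if dim S = j then (-1) ^ (card S + dim S) else 0)"

text \<open>The contribution of the single flat \<open>H\<close> to
  \<open>whitney_num (dim H)\<close>; it is 0 when \<open>V\<close> contains no spanning set of
  \<open>H\<close>.\<close>

definition span_num :: "'a::euclidean_space set \<Rightarrow> 'a set \<Rightarrow> int"
  where "span_num H V = (\<Sum>S\<in>Pow V. if span S = H then (-1) ^ (card S + dim S) else 0)"

text \<open>Multiplication of the generating polynomial of \<open>a\<close> by \<open>1 + x\<close>:
  the effect of a vector that is generic in the whole space, below the top rank.\<close>

definition pascal :: "(nat \<Rightarrow> int) \<Rightarrow> nat \<Rightarrow> int"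
  where "pascal a j = a j + (if j = 0 then 0 else a (j - 1))"

lemma
  fixes v :: "'a::euclidean_space"
  shows dim_insert_in: "v \<in> span S \<Longrightarrow> dim (insert v S) = dim S"
  and dim_insert_notin: "v \<notin> span S \<Longrightarrow> dim (insert v S) = Suc (dim S)"
  by (simp_all add: dim_insert)

text \<open>A set \<open>S\<close> whose rank \<open>v\<close> does not raise spans at least
  \<open>H\<close>, so it is invisible below rank \<open>dim H\<close>. For all other sets
  \<open>v\<close> raises both cardinality and rank by one and keeps the sign.\<close>

lemma whitney_num_insert:
  assumes V: "finite V" "v \<notin> V" and g: "generic_in v H V" and j: "j < dim H"
  shows "whitney_num j (insert v V) = pascal (\<lambda>i. whitney_num i V) j"
proof -
  let ?\<phi> = "\<lambda>j S. if dim S = j then (-1::int) ^ (card S + dim S) else 0"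
  have "?\<phi> j (insert v S) = (if j = 0 then 0 else ?\<phi> (j - 1) S)" if "S \<in> Pow V" for S
  proof -
    have S: "S \<subseteq> V" "v \<notin> S" "finite S" using that V finite_subset by auto
    show ?thesis
    proof (cases "v \<in> span S")
      case True
      then have "dim H \<le> dim S" using generic_in_span_iff[OF g S(1)] subspace_dim_le_span by blast
      then show ?thesis using j dim_insert_in[OF True] by auto
    next
      case False
      then show ?thesis using S by (auto simp: dim_insert_notin[OF False])
    qed
  qed
  then show ?thesis
    unfolding whitney_num_def pascal_def sum_Pow_insert[OF V] sum.distrib by simp
qed

text \<open>At rank \<open>dim H\<close> the only exceptions to the Pascal recursion are the sets
  with span exactly \<open>H\<close>: adding \<open>v\<close> keeps their rank and flips their
  sign.\<close>

lemma whitney_num_insert_top: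
  assumes V: "finite V" "v \<notin> V" and g: "generic_in v H V" and H: "subspace H" "dim H > 0"
  shows "whitney_num (dim H) (insert v V) = pascal (\<lambda>i. whitney_num i V) (dim H) - span_num H V"
proof -
  let ?\<phi> = "\<lambda>j S. if dim S = j then (-1::int) ^ (card S + dim S) else 0"
  let ?\<psi> = "\<lambda>S. if span S = H then (-1::int) ^ (card S + dim S) else 0"
  obtain q where q: "dim H = Suc q" using H(2) gr0_conv_Suc by blast
  have "?\<phi> (dim H) (insert v S) = ?\<phi> (dim H - 1) S - ?\<psi> S" if "S \<in> Pow V" for S
  proof -
    have S: "S \<subseteq> V" "v \<notin> S" "finite S" using that V finite_subset by auto
    show ?thesis
    proof (cases "v \<in> span S")
      case True
      then have HS: "H \<subseteq> span S" using generic_in_span_iff[OF g S(1)] by blast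
      then have d: "dim H \<le> dim S" by (rule subspace_dim_le_span)
      have "dim S = dim H \<longleftrightarrow> span S = H"
      proof
        assume "dim S = dim H"
        then have "H = span S" using HS H by (intro subspace_dim_equal) auto
        then show "span S = H" by (rule sym)
      qed (metis dim_span)
      then show ?thesis using S d H(2) dim_insert_in[OF True] by auto
    next
      case False
      then have "span S \<noteq> H" using generic_in_span_iff[OF g S(1)] by blast
      then show ?thesis using S by (auto simp: dim_insert_notin[OF False] q)
    qed
  qed
  then have "(\<Sum>S\<in>Pow V. ?\<phi> (dim H) (insert v S)) = (\<Sum>S\<in>Pow V. ?\<phi> (dim H - 1) S - ?\<psi> S)"
    by (rule sum.cong[OF refl])
  then show ?thesis
    unfolding whitney_num_def span_num_def pascal_def sum_Pow_insert[OF V] sum.distrib sum_subtractf q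
    by simp
qed

text \<open>Sets already spanning \<open>H\<close> cancel against themselves with \<open>v\<close>
  added. What remains are the sets inside \<open>H\<close> of rank one less, which \<open>v\<close>
  completes to a spanning set.\<close>

lemma span_num_insert:
  assumes V: "finite V" "v \<notin> V" and g: "generic_in v H V" and H: "subspace H" "dim H > 0"
  shows "span_num H (insert v V) = whitney_num (dim H - 1) (V \<inter> H)"
proof -
  let ?\<psi> = "\<lambda>S. if span S = H then (-1::int) ^ (card S + dim S) else 0"
  let ?\<phi> = "\<lambda>S. if dim S = dim H - 1 then (-1::int) ^ (card S + dim S) else 0"
  obtain q where q: "dim H = Suc q" using H(2) gr0_conv_Suc by blast
  have vH: "v \<in> H" using g unfolding generic_in_def by blast
  have "?\<psi> S + ?\<psi> (insert v S) = (if S \<subseteq> H then ?\<phi> S else 0)" if "S \<in> Pow V" for S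
  proof -
    have S: "S \<subseteq> V" "v \<notin> S" "finite S" using that V finite_subset by auto
    show ?thesis
    proof (cases "v \<in> span S")
      case True
      then have "H \<subseteq> span S" using generic_in_span_iff[OF g S(1)] by blast
      then have "dim H \<le> dim S" by (rule subspace_dim_le_span)
      moreover have "span (insert v S) = span S" using True by (rule span_redundant)
      ultimately show ?thesis using S H(2) dim_insert_in[OF True] by auto
    next
      case False
      then have "span S \<noteq> H" using generic_in_span_iff[OF g S(1)] by blast
      moreover have "span (insert v S) = H \<longleftrightarrow> S \<subseteq> H \<and> dim S = dim H - 1"
      proof
        assume a: "span (insert v S) = H"
        then have "dim H = Suc (dim S)" using dim_insert_notin[OF False] by (metis dim_span)
        moreover have "S \<subseteq> H" using a span_superset[of "insert v S"] by blast
        ultimately show "S \<subseteq> H \<and> dim S = dim H - 1" by simp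
      next
        assume a: "S \<subseteq> H \<and> dim S = dim H - 1"
        then have "span (insert v S) \<subseteq> H" using vH H(1) by (intro span_minimal) auto
        moreover have "dim (span (insert v S)) = dim H"
          using a H(2) dim_insert_notin[OF False] by simp
        ultimately show "span (insert v S) = H" using H(1) by (intro subspace_dim_equal) auto
      qed
      ultimately show ?thesis using S by (auto simp: dim_insert_notin[OF False] q)
    qed
  qed
  then have "span_num H (insert v V) = (\<Sum>S\<in>Pow V. if S \<subseteq> H then ?\<phi> S else 0)"
    unfolding span_num_def sum_Pow_insert[OF V] by (intro sum.cong) auto
  also have "\<dots> = (\<Sum>S\<in>Pow V \<inter> {S. S \<subseteq> H}. ?\<phi> S)"
    by (subst sum.inter_restrict) (simp_all add: V(1))
  also have "Pow V \<inter> {S. S \<subseteq> H} = Pow (V \<inter> H)" by blast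
  finally show ?thesis unfolding whitney_num_def .
qed

lemma whitney_num_eq_span_num:
  assumes "V \<subseteq> X" "subspace X"
  shows "whitney_num (dim X) V = span_num X V"
proof -
  have "dim S = dim X \<longleftrightarrow> span S = X" if "S \<subseteq> V" for S
  proof
    assume "dim S = dim X"
    moreover have "span S \<subseteq> X" using that assms by (intro span_minimal) auto
    ultimately show "span S = X" using assms by (intro subspace_dim_equal) auto
  qed (metis dim_span)
  then show ?thesis unfolding whitney_num_def span_num_def by (intro sum.cong) auto
qed

text \<open>With all vectors inside \<open>X\<close>, the top rank is the rank of the flat
  \<open>X\<close> itself, so the top Whitney number follows from
  \<open>span_num_insert\<close>.\<close>

lemma whitney_num_insert_full:
  assumes V: "finite V" "v \<notin> V" "V \<subseteq> X" and g: "generic_in v X V" and X: "subspace X" "dim X > 0"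
  shows "whitney_num (dim X) (insert v V) = whitney_num (dim X - 1) V"
proof -
  have "insert v V \<subseteq> X" using g V unfolding generic_in_def by blast
  then show ?thesis
    using whitney_num_eq_span_num[OF _ X(1)] span_num_insert[OF V(1,2) g X] V(3)
    by (metis inf.absorb1)
qed

lemma whitney_num_empty: "whitney_num j {} = (if j = 0 then 1 else 0)"
  unfolding whitney_num_def by simp

text \<open>Sets spanning \<open>X\<close> cancel against themselves with \<open>v\<close> added,
  and all other sets count twice. A final generic vector thus makes the Whitney number of top rank
  irrelevant, and the lower ones give the number of regions directly.\<close>

lemma signed_rank_sum_insert_generic:
  assumes V: "finite V" "v \<notin> V" "V \<subseteq> X" and g: "generic_in v X V" and X: "subspace X" "dim X = Suc q"
  shows "signed_rank_sum (insert v V) = 2 * (\<Sum>j\<le>q. whitney_num j V)"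
proof -
  let ?\<phi> = "\<lambda>S. (-1::int) ^ (card S + dim S)"
  have "?\<phi> S + ?\<phi> (insert v S) = (if dim S \<le> q then 2 * ?\<phi> S else 0)" if "S \<in> Pow V" for S
  proof -
    have S: "S \<subseteq> V" "v \<notin> S" "finite S" using that V finite_subset by auto
    have le: "dim S \<le> Suc q" using dim_subset[of S X] S(1) V(3) X by simp
    show ?thesis
    proof (cases "v \<in> span S")
      case True
      then have "dim X \<le> dim S" using generic_in_span_iff[OF g S(1)] subspace_dim_le_span by blast
      then show ?thesis using S X(2) dim_insert_in[OF True] by simp
    next
      case False
      have "dim S \<noteq> Suc q"
      proof
        assume "dim S = Suc q"
        moreover have "span S \<subseteq> X" using S V X(1) by (intro span_minimal) auto
        ultimately have "span S = X" using X by (intro subspace_dim_equal) auto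
        then show False using False g unfolding generic_in_def by blast
      qed
      then show ?thesis using S le by (simp add: dim_insert_notin[OF False])
    qed
  qed
  then have "signed_rank_sum (insert v V) = (\<Sum>S\<in>Pow V. if dim S \<le> q then 2 * ?\<phi> S else 0)"
    unfolding signed_rank_sum_def sum_Pow_insert[OF V(1,2)] by (intro sum.cong) auto
  also have "\<dots> = (\<Sum>S\<in>Pow V. \<Sum>j\<le>q. 2 * (if dim S = j then ?\<phi> S else 0))"
    by (intro sum.cong refl) (simp add: sum.delta flip: sum_distrib_left)
  also have "\<dots> = 2 * (\<Sum>j\<le>q. whitney_num j V)"
    unfolding whitney_num_def by (subst sum.swap) (simp flip: sum_distrib_left)
  finally show ?thesis .
qed

text \<open>Take the orthogonal complement in \<open>X\<close> of a vector \<open>a\<close> that is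
  orthogonal to no vector of \<open>V\<close>.\<close>

lemma subspace_avoiding:
  fixes X :: "'a::euclidean_space set"
  assumes V: "finite V" "V \<subseteq> X" "0 \<notin> V" and X: "subspace X" "dim X = Suc q"
  shows "\<exists>H. subspace H \<and> H \<subseteq> X \<and> dim H = q \<and> H \<inter> V = {}"
proof -
  have "\<exists>a\<in>X. \<forall>Y\<in>insert {0} ((\<lambda>v. {x. v \<bullet> x = 0}) ` V). a \<notin> Y"
  proof (rule avoid_finite_subspaces[OF _ X(1)])
    fix Y assume "Y \<in> insert {0} ((\<lambda>v. {x. v \<bullet> x = 0}) ` V)"
    then consider "Y = {0}" | v where "v \<in> V" "Y = {x. v \<bullet> x = 0}" by blast
    then show "subspace Y \<and> \<not> X \<subseteq> Y"
    proof cases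
      case 1
      have "\<not> X \<subseteq> {0}"
      proof
        assume "X \<subseteq> {0}"
        then have "dim X = 0" by simp
        then show False using X(2) by linarith
      qed
      then show ?thesis using 1 by simp
    next
      case 2
      then have "v \<in> X" "v \<notin> Y" using V by auto
      then show ?thesis using 2(2) subspace_hyperplane by blast
    qed
  qed (use V in simp)
  then obtain a where a: "a \<in> X" "a \<noteq> 0" "\<forall>v\<in>V. v \<bullet> a \<noteq> 0" by auto
  have "dim X = Suc (dim {x \<in> X. a \<bullet> x = 0})"
    using a by (intro dim_orth1[OF X(1)] bexI[of _ a]) auto
  moreover have "{x \<in> X. a \<bullet> x = 0} \<inter> V = {}" using a(3) by (auto simp: inner_commute)
  ultimately show ?thesis
    using X subspace_orth1[OF X(1), of a] by (intro exI[of _ "{x \<in> X. a \<bullet> x = 0}"]) auto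
qed

section \<open>Groups of vectors in common subspaces\<close>

lemma pascal_0: "pascal a 0 = a 0"
  and pascal_Suc: "pascal a (Suc i) = a (Suc i) + a i"
  unfolding pascal_def by simp_all

lemma pascal_cong:
  "(\<And>j. j \<le> J \<Longrightarrow> a j = b j) \<Longrightarrow> j \<le> J \<Longrightarrow> pascal a j = pascal b j"
  unfolding pascal_def by auto

lemma pascal_funpow_cong:
  assumes "\<And>j. j \<le> J \<Longrightarrow> a j = b j"
  shows "j \<le> J \<Longrightarrow> (pascal ^^ k) a j = (pascal ^^ k) b j"
  using assms
proof (induction k arbitrary: j)
  case (Suc k)
  then show ?case using pascal_cong[of J "(pascal ^^ k) a" "(pascal ^^ k) b" j] by simp
qed simp

text \<open>The new vectors are generic in a subspace \<open>H\<close> of codimension one in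
  \<open>X\<close> that contains no old vector. Only rank \<open>q\<close> notices this: each new
  vector loses \<open>span_num H\<close> there, and these losses add up to
  \<open>(m - 1) choose q\<close> by Pascal's rule.\<close>

lemma add_group:
  fixes X :: "'a::euclidean_space set"
  assumes V: "simple_vectors V" "V \<subseteq> X" and X: "subspace X" "dim X = Suc q" and q: "q \<ge> 2"
  shows "\<exists>V'. V \<subseteq> V' \<and> V' \<subseteq> X \<and> simple_vectors V' \<and> card V' = card V + m \<and>
    (\<forall>j\<le>q. whitney_num j V' = (pascal ^^ m) (\<lambda>i. whitney_num i V) j
      - (if j = q then int ((m - 1) choose q) else 0))"
proof -
  have V0: "finite V" "0 \<notin> V" using V(1) unfolding simple_vectors_def by auto
  obtain H where H: "subspace H" "H \<subseteq> X" "dim H = q" "H \<inter> V = {}"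
    using subspace_avoiding[OF V0(1) V(2) V0(2) X] by blast
  let ?w = "\<lambda>i. whitney_num i V"
  \<comment> \<open>The last two claims drive the induction: the Whitney numbers of \<open>G\<close>
    alone determine \<open>span_num H\<close>, because \<open>G\<close> is all that
    \<open>V \<union> G\<close> has in \<open>H\<close>, and \<open>span_num H\<close> is the loss
    caused by the next vector.\<close>
  have "\<exists>G. G \<subseteq> H \<and> card G = m \<and> simple_vectors (V \<union> G) \<and>
      (\<forall>j<q. whitney_num j (V \<union> G) = (pascal ^^ m) ?w j) \<and>
      whitney_num q (V \<union> G) = (pascal ^^ m) ?w q - int ((m - 1) choose q) \<and>
      (\<forall>j<q. whitney_num j G = int (m choose j)) \<and>
      span_num H (V \<union> G) = (if m = 0 then 0 else int ((m - 1) choose (q - 1)))"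
  proof (induction m)
    case 0
    have "span_num H V = 0"
      unfolding span_num_def
    proof (intro sum.neutral ballI)
      fix S assume S: "S \<in> Pow V"
      have "span S \<noteq> H"
      proof
        assume a: "span S = H"
        then have "S \<subseteq> H" using span_superset[of S] by blast
        then have "S = {}" using S H(4) by blast
        then have "dim H = 0" using a by auto
        then show False using H(3) q by linarith
      qed
      then show "(if span S = H then (-1::int) ^ (card S + dim S) else 0) = 0" by simp
    qed
    then show ?case using V q by (intro exI[of _ "{}"]) (simp add: whitney_num_empty)
  next
    case (Suc m)
    then obtain G where G: "G \<subseteq> H" "card G = m" "simple_vectors (V \<union> G)"
      "\<And>j. j < q \<Longrightarrow> whitney_num j (V \<union> G) = (pascal ^^ m) ?w j"
      "whitney_num q (V \<union> G) = (pascal ^^ m) ?w q - int ((m - 1) choose q)"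
      "\<And>j. j < q \<Longrightarrow> whitney_num j G = int (m choose j)"
      "span_num H (V \<union> G) = (if m = 0 then 0 else int ((m - 1) choose (q - 1)))" by blast
    have fin: "finite (V \<union> G)" using G(3) unfolding simple_vectors_def by blast
    obtain v where v: "generic_in v H (V \<union> G)" using generic_in_exists[OF fin H(1)] by blast
    have d2: "dim H \<ge> 2" "dim H > 0" using H(3) q by auto
    have vn: "v \<notin> V \<union> G" by (rule generic_in_not_mem[OF v d2(1)])
    have ins: "V \<union> insert v G = insert v (V \<union> G)" by blast
    have vG: "generic_in v H G" using generic_in_mono[OF v] by blast
    have VGH: "(V \<union> G) \<inter> H = G" using G(1) H(4) by blast
    have 1: "insert v G \<subseteq> H" using G(1) v unfolding generic_in_def by blast
    have 2: "card (insert v G) = Suc m" using vn fin G(2) by simp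
    have 3: "simple_vectors (V \<union> insert v G)"
      unfolding ins by (rule simple_vectors_insert_generic[OF v d2(1) G(3)])
    have 4: "whitney_num j (V \<union> insert v G) = (pascal ^^ Suc m) ?w j" if "j < q" for j
      unfolding ins using whitney_num_insert[OF fin vn v, of j] that H(3)
        pascal_cong[of "q - 1" "\<lambda>i. whitney_num i (V \<union> G)" "(pascal ^^ m) ?w" j] G(4) by simp
    have 5: "whitney_num q (V \<union> insert v G) = (pascal ^^ Suc m) ?w q - int ((Suc m - 1) choose q)"
    proof -
      obtain q' where q': "q = Suc q'" using q by (cases q) auto
      have "whitney_num q (V \<union> insert v G) = pascal (\<lambda>i. whitney_num i (V \<union> G)) q - span_num H (V \<union> G)"
        unfolding ins using whitney_num_insert_top[OF fin vn v H(1) d2(2)] H(3) by simp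
      then show ?thesis using G(4)[of q'] G(5,7) q' by (cases m) (simp_all add: pascal_def)
    qed
    have 6: "whitney_num j (insert v G) = int (Suc m choose j)" if "j < q" for j
    proof -
      have "whitney_num j (insert v G) = pascal (\<lambda>i. whitney_num i G) j"
        using fin vn that H(3) by (intro whitney_num_insert[OF _ _ vG]) auto
      then show ?thesis using G(6)[of j] G(6)[of "j - 1"] that unfolding pascal_def by (cases j) auto
    qed
    have 7: "span_num H (V \<union> insert v G) = int (m choose (q - 1))"
      unfolding ins using span_num_insert[OF fin vn v H(1) d2(2)] VGH H(3) G(6)[of "q - 1"] q by simp
    show ?case by (intro exI[of _ "insert v G"]) (use 1 2 3 4 5 6 7 in simp)
  qed
  then obtain G where G: "G \<subseteq> H" "card G = m" "simple_vectors (V \<union> G)"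
      "\<forall>j<q. whitney_num j (V \<union> G) = (pascal ^^ m) ?w j"
      "whitney_num q (V \<union> G) = (pascal ^^ m) ?w q - int ((m - 1) choose q)" by blast
  have "V \<inter> G = {}" using G(1) H(4) by blast
  moreover have "finite G" using G(3) unfolding simple_vectors_def by auto
  ultimately have "card (V \<union> G) = card V + m" using V0(1) G(2) by (simp add: card_Un_disjoint)
  then show ?thesis using G H(2) V(2) by (intro exI[of _ "V \<union> G"]) auto
qed

lemma add_groups:
  fixes X :: "'a::euclidean_space set"
  assumes V: "simple_vectors V" "V \<subseteq> X" and X: "subspace X" "dim X = Suc q" and q: "q \<ge> 2"
  shows "\<exists>V'. V \<subseteq> V' \<and> V' \<subseteq> X \<and> simple_vectors V' \<and> card V' = card V + sum_list ms \<and>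
    (\<forall>j\<le>q. whitney_num j V' = (pascal ^^ sum_list ms) (\<lambda>i. whitney_num i V) j
      - (if j = q then int (\<Sum>m\<leftarrow>ms. (m - 1) choose q) else 0))"
proof (induction ms)
  case Nil
  then show ?case using V by (intro exI[of _ V]) simp
next
  case (Cons m ms)
  let ?w = "\<lambda>i. whitney_num i V"
  obtain V1 where V1: "V \<subseteq> V1" "V1 \<subseteq> X" "simple_vectors V1" "card V1 = card V + sum_list ms"
    "\<And>j. j \<le> q \<Longrightarrow> whitney_num j V1 = (pascal ^^ sum_list ms) ?w j
      - (if j = q then int (\<Sum>m\<leftarrow>ms. (m - 1) choose q) else 0)"
    using Cons.IH by blast
  obtain V2 where V2: "V1 \<subseteq> V2" "V2 \<subseteq> X" "simple_vectors V2" "card V2 = card V1 + m"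
    "\<And>j. j \<le> q \<Longrightarrow> whitney_num j V2 = (pascal ^^ m) (\<lambda>i. whitney_num i V1) j
      - (if j = q then int ((m - 1) choose q) else 0)"
    using add_group[OF V1(3,2) X q, of m] by blast
  \<comment> \<open>A correction at rank \<open>q\<close> is only copied at \<open>q\<close> or
    pushed to rank \<open>q + 1\<close>, which is not tracked; so the losses of different groups
    simply add up.\<close>
  have top: "(pascal ^^ m) (\<lambda>i. a i - (if i = q then c else 0)) j
      = (pascal ^^ m) a j - (if j = q then c else 0)" if "j \<le> q" for a c j
    using that by (induction m arbitrary: j) (auto simp: pascal_def)
  have "whitney_num j V2 = (pascal ^^ sum_list (m # ms)) ?w j
      - (if j = q then int (\<Sum>m\<leftarrow>m # ms. (m - 1) choose q) else 0)" if j: "j \<le> q" for j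
  proof -
    have "(pascal ^^ m) (\<lambda>i. whitney_num i V1) j
        = (pascal ^^ m) (\<lambda>i. (pascal ^^ sum_list ms) ?w i
            - (if i = q then int (\<Sum>m\<leftarrow>ms. (m - 1) choose q) else 0)) j"
      by (rule pascal_funpow_cong[OF V1(5) j])
    also have "\<dots> = (pascal ^^ m) ((pascal ^^ sum_list ms) ?w) j
        - (if j = q then int (\<Sum>m\<leftarrow>ms. (m - 1) choose q) else 0)"
      by (rule top[OF j])
    finally show ?thesis using V2(5)[OF j] by (simp add: funpow_add)
  qed
  moreover have "card V2 = card V + sum_list (m # ms)" using V1(4) V2(4) by simp
  ultimately show ?case using V1(1) V2(1,2,3) by (intro exI[of _ V2]) auto
qed

text \<open>Each step retains the correction \<open>a\<close> at rank \<open>p\<close> and passes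
  one further copy of it to rank \<open>p + 1\<close>, which explains the summand
  \<open>int k * a\<close>.\<close>

lemma pascal_funpow_binomial:
  fixes a b :: int
  assumes "j \<le> Suc p"
  shows "(pascal ^^ k) (\<lambda>j. int (N choose j) - (if j = p then a else 0) - (if j = Suc p then b else 0)) j
    = int ((N + k) choose j) - (if j = p then a else 0) - (if j = Suc p then b + int k * a else 0)"
  using assms
proof (induction k arbitrary: j)
  case (Suc k)
  let ?f = "\<lambda>j. int (N choose j) - (if j = p then a else 0) - (if j = Suc p then b else 0)"
  show ?case
  proof (cases j)
    case 0
    then show ?thesis using Suc.IH[of 0] by (simp add: pascal_0)
  next
    case (Suc i)
    have "(pascal ^^ Suc k) ?f (Suc i) = (pascal ^^ k) ?f (Suc i) + (pascal ^^ k) ?f i"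
      by (simp only: funpow.simps o_apply pascal_Suc)
    also have "\<dots> = int ((N + k) choose Suc i) - (if Suc i = p then a else 0)
        - (if Suc i = Suc p then b + int k * a else 0)
        + (int ((N + k) choose i) - (if i = p then a else 0) - (if i = Suc p then b + int k * a else 0))"
      using Suc.prems Suc by (simp only: Suc.IH)
    finally show ?thesis using Suc.prems Suc by (auto simp: algebra_simps)
  qed
qed simp

text \<open>Vectors in the \<open>e\<close>-dimensional subspace \<open>Y\<close> are normals of
  hyperplanes through a common point. There \<open>B\<close> consists of the groups
  \<open>ps\<close>, each in a subspace of dimension \<open>e - 1\<close>, and \<open>b\<close> is
  generic. The groups \<open>ms\<close>, each in a subspace of dimension \<open>e\<close>, and a
  generic \<open>v\<close> are then added in \<open>X\<close>. The vectors \<open>b\<close> and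
  \<open>v\<close> account for the two summands 1 in the assumptions.\<close>

lemma two_level_vectors:
  fixes X :: "'a::euclidean_space set"
  assumes e: "e \<ge> 3" "Suc e \<le> DIM('a)" and N: "sum_list ps + 1 = N" and k: "sum_list ms + 1 = k"
  shows "\<exists>V :: 'a set. simple_vectors V \<and> card V = N + k \<and>
    signed_rank_sum V = 2 * (int (\<Sum>j\<le>e. (N + k - 1) choose j) - int ((N - 1) choose e)
      - int (k + 1) * int (\<Sum>p\<leftarrow>ps. (p - 1) choose (e - 1)) - int (\<Sum>m\<leftarrow>ms. (m - 1) choose e))"
proof -
  obtain X :: "'a set" where X: "subspace X" "dim X = Suc e"
    using choose_subspace_of_subspace[of "Suc e" "UNIV::'a set"] e(2) by auto
  obtain Y :: "'a set" where Y: "subspace Y" "dim Y = e" "Y \<subseteq> X"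
    using choose_subspace_of_subspace[of e X] X by (auto simp: span_eq_iff[THEN iffD2])
  obtain p where p: "e = Suc p" "p \<ge> 2" using e(1) by (cases e) auto
  define x where "x = (\<Sum>q\<leftarrow>ps. (q - 1) choose p)"
  define z where "z = (\<Sum>m\<leftarrow>ms. (m - 1) choose e)"
  have dY: "dim Y = Suc p" "dim Y > 0" "dim Y \<ge> 2" using Y(2) p by auto
  have "simple_vectors ({}::'a set)" unfolding simple_vectors_def by simp
  then obtain B where B: "B \<subseteq> Y" "simple_vectors B" "card B = N - 1"
    "\<And>j. j \<le> p \<Longrightarrow> whitney_num j B = (pascal ^^ (N - 1)) (\<lambda>i. whitney_num i ({}::'a set)) j
      - (if j = p then int x else 0)"
    using add_groups[of "{}" Y p ps] Y(1) dY(1) p(2) N unfolding x_def by force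
  have wB: "whitney_num j B = int ((N - 1) choose j) - (if j = p then int x else 0)" if "j \<le> p" for j
  proof -
    have "(\<lambda>i. whitney_num i ({}::'a set))
        = (\<lambda>j. int (0 choose j) - (if j = p then 0 else 0) - (if j = Suc p then 0 else 0))"
      by (auto simp: fun_eq_iff whitney_num_empty binomial_eq_0)
    then show ?thesis using B(4)[OF that] pascal_funpow_binomial[of j p "N - 1" 0 0 0] that by simp
  qed
  have fB: "finite B" using B(2) unfolding simple_vectors_def by blast
  obtain b where b: "generic_in b Y B" using generic_in_exists[OF fB Y(1)] by blast
  define M where "M = insert b B"
  have bB: "b \<notin> B" by (rule generic_in_not_mem[OF b dY(3)])
  have M: "simple_vectors M" "M \<subseteq> X" "card M = N"
    unfolding M_def using simple_vectors_insert_generic[OF b dY(3) B(2)] B(1,3) b Y(3) bB fB N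
    by (auto simp: generic_in_def)
  \<comment> \<open>At rank \<open>e = dim Y\<close> the value is \<open>whitney_num p B\<close>
    instead of its Pascal successor, which costs \<open>(N - 1) choose e\<close> and one copy of
    \<open>x\<close>.\<close>
  have wM: "whitney_num j M = int (N choose j) - (if j = p then int x else 0)
      - (if j = Suc p then int ((N - 1) choose e) + int x else 0)" if "j \<le> Suc p" for j
  proof (cases "j = Suc p")
    case True
    have "whitney_num j M = whitney_num p B"
      unfolding M_def True using whitney_num_insert_full[OF fB bB B(1) b Y(1) dY(2)] dY(1) by simp
    moreover have "N choose Suc p = ((N - 1) choose p) + ((N - 1) choose Suc p)"
      using N by (cases N) auto
    ultimately show ?thesis using wB[of p] True p(1) by simp
  next
    case False
    then have "whitney_num j M = pascal (\<lambda>i. whitney_num i B) j"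
      unfolding M_def using whitney_num_insert[OF fB bB b, of j] dY(1) that by simp
    also have "\<dots> = int (N choose j) - (if j = p then int x else 0)"
      using False that N wB[of j] wB[of "j - 1"] unfolding pascal_def by (cases N; cases j) auto
    finally show ?thesis using False by simp
  qed
  have e2: "e \<ge> 2" using e by simp
  obtain V where V: "V \<subseteq> X" "simple_vectors V" "card V = N + (k - 1)"
    "\<And>j. j \<le> e \<Longrightarrow> whitney_num j V = (pascal ^^ (k - 1)) (\<lambda>i. whitney_num i M) j
      - (if j = e then int z else 0)"
    using add_groups[OF M(1,2) X e2, of ms] k M(3) unfolding z_def by force
  \<comment> \<open>The defect \<open>x\<close> at rank \<open>p\<close> reaches rank
    \<open>e\<close> once from \<open>M\<close> and once for each of the \<open>k - 1\<close> later
    vectors. Together with rank \<open>p\<close> itself this makes the factor \<open>k + 1\<close>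
    in the total.\<close>
  have wV: "whitney_num j V = int ((N + k - 1) choose j) - (if j = p then int x else 0)
      - (if j = e then int ((N - 1) choose e) + int k * int x + int z else 0)" if j: "j \<le> e" for j
  proof -
    have "(pascal ^^ (k - 1)) (\<lambda>i. whitney_num i M) j
      = int ((N + (k - 1)) choose j) - (if j = p then int x else 0)
      - (if j = Suc p then int ((N - 1) choose e) + int x + int (k - 1) * int x else 0)"
      using pascal_funpow_cong[OF wM, where j = j and k = "k - 1"] pascal_funpow_binomial[of j p "k - 1" N] j p(1)
      by simp
    then show ?thesis using V(4)[OF j] k p(1) by (auto simp: algebra_simps)
  qed
  have fV: "finite V" using V(2) unfolding simple_vectors_def by blast
  obtain v where v: "generic_in v X V" using generic_in_exists[OF fV X(1)] by blast
  have dX: "dim X \<ge> 2" using X(2) e by simp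
  have vV: "v \<notin> V" by (rule generic_in_not_mem[OF v dX])
  have "signed_rank_sum (insert v V) = 2 * (\<Sum>j\<le>e. whitney_num j V)"
    by (rule signed_rank_sum_insert_generic[OF fV vV V(1) v X])
  also have "(\<Sum>j\<le>e. whitney_num j V) = (\<Sum>j\<le>e. int ((N + k - 1) choose j) - (if j = p then int x else 0)
      - (if j = e then int ((N - 1) choose e) + int k * int x + int z else 0))"
    by (intro sum.cong refl wV) simp
  also have "\<dots> = int (\<Sum>j\<le>e. (N + k - 1) choose j) - int ((N - 1) choose e) - int (k + 1) * int x - int z"
    using p(1) by (simp add: sum_subtractf sum.delta algebra_simps)
  finally have "signed_rank_sum (insert v V) = 2 * (int (\<Sum>j\<le>e. (N + k - 1) choose j)
      - int ((N - 1) choose e) - int (k + 1) * int x - int z)" .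
  moreover have "card (insert v V) = N + k" using vV fV V(3) k by simp
  ultimately show ?thesis
    using simple_vectors_insert_generic[OF v dX V(2)] p(1) unfolding x_def z_def
    by (intro exI[of _ "insert v V"]) simp
qed

section \<open>Planar arrangements\<close>

lemma dim_eq_2_iff:
  fixes x y :: "'a::euclidean_space"
  assumes "x \<in> S" "y \<in> S" "x \<notin> span {y}" "y \<noteq> 0"
  shows "dim S = 2 \<longleftrightarrow> S \<subseteq> span {x, y}"
proof -
  have d: "dim {x, y} = 2" using assms(3,4) by (simp add: dim_insert)
  have sub: "span {x, y} \<subseteq> span S" using assms(1,2) by (intro span_mono) auto
  show ?thesis
  proof
    assume "dim S = 2"
    then have "span {x, y} = span S" using sub d by (intro subspace_dim_equal) auto
    then show "S \<subseteq> span {x, y}" using span_superset[of S] by blast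
  next
    assume "S \<subseteq> span {x, y}"
    then have "span S \<subseteq> span {x, y}" by (intro span_minimal) auto
    then have "span S = span {x, y}" using sub by blast
    then show "dim S = 2" using d dim_span by metis
  qed
qed

lemma in_span_pair: "z \<in> span {x, y} \<longleftrightarrow> (\<exists>\<alpha> \<beta>. z = \<alpha> *\<^sub>R x + \<beta> *\<^sub>R y)"
proof -
  have "z \<in> span {x, y} \<longleftrightarrow> (\<exists>\<alpha> \<beta>. z - \<alpha> *\<^sub>R x = \<beta> *\<^sub>R y)"
    unfolding span_breakdown_eq[of z x "{y}"] span_singleton by auto
  then show ?thesis by (simp add: diff_eq_eq add.commute)
qed

text \<open>
  The points \<open>a i\<close> lie on a parabola and the points \<open>p s\<close> on the line at infinity. The chord
  through \<open>a i\<close> and \<open>a l\<close> has slope \<open>2 ^ i + 2 ^ l\<close>, so distinct chords have distinct slopes.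
\<close>

locale conic_and_line =
  fixes e1 e2 e3 :: "'a::euclidean_space"
  assumes basis: "e1 \<in> Basis" "e2 \<in> Basis" "e3 \<in> Basis" and distinct: "e1 \<noteq> e2" "e1 \<noteq> e3" "e2 \<noteq> e3"
begin

text \<open>As normals, the vectors \<open>a i\<close> give the generic lines, no three of them
  being dependent. The vectors \<open>p s\<close> all lie in the plane spanned by \<open>e2\<close>
  and \<open>e3\<close>, so they give the lines of the pencil.\<close>

definition a :: "nat \<Rightarrow> 'a" where "a i = e1 + (2 ^ i) *\<^sub>R e2 + (4 ^ i) *\<^sub>R e3"
definition p :: "real \<Rightarrow> 'a" where "p s = e2 + s *\<^sub>R e3"

lemma inner_e [simp]:
  "e1 \<bullet> e1 = 1" "e2 \<bullet> e2 = 1" "e3 \<bullet> e3 = 1"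
  "e1 \<bullet> e2 = 0" "e1 \<bullet> e3 = 0" "e2 \<bullet> e3 = 0" "e2 \<bullet> e1 = 0" "e3 \<bullet> e1 = 0" "e3 \<bullet> e2 = 0"
  using basis distinct by (auto simp: inner_same_Basis inner_not_same_Basis)

lemma coords [simp]:
  "a i \<bullet> e1 = 1" "a i \<bullet> e2 = 2 ^ i" "a i \<bullet> e3 = 4 ^ i"
  "p s \<bullet> e1 = 0" "p s \<bullet> e2 = 1" "p s \<bullet> e3 = s"
  unfolding a_def p_def by (simp_all add: inner_add_left)

lemma a_eq_iff: "a i = a l \<longleftrightarrow> i = l"
proof
  assume "a i = a l"
  then have "a i \<bullet> e2 = a l \<bullet> e2" by simp
  then show "i = l" by simp
qed simp

lemma p_eq_iff: "p s = p t \<longleftrightarrow> s = t"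
  by (metis coords(6))

lemma a_neq_p: "a i \<noteq> p s"
  by (metis coords(1,4) zero_neq_one)

lemma nonzero: "a i \<noteq> 0" "p s \<noteq> 0"
  by (metis coords(1) inner_zero_left zero_neq_one, metis coords(5) inner_zero_left zero_neq_one)

lemma not_in_span_single:
  "i \<noteq> l \<Longrightarrow> a i \<notin> span {a l}" "a i \<notin> span {p s}" "p s \<notin> span {a i}" "s \<noteq> t \<Longrightarrow> p s \<notin> span {p t}"
proof -
  have c: "x \<notin> span {y}" if "\<And>c. x = c *\<^sub>R y \<Longrightarrow> False" for x y :: 'a
    using that by (auto simp: span_singleton)
  show "a i \<notin> span {a l}" if "i \<noteq> l"
  proof (rule c)
    fix c assume h: "a i = c *\<^sub>R a l"
    have "c = 1" using arg_cong[OF h, of "\<lambda>v. v \<bullet> e1"] by simp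
    then show False using h that a_eq_iff by simp
  qed
  show "a i \<notin> span {p s}"
  proof (rule c)
    fix c assume h: "a i = c *\<^sub>R p s"
    show False using arg_cong[OF h, of "\<lambda>v. v \<bullet> e1"] by simp
  qed
  show "p s \<notin> span {a i}"
  proof (rule c)
    fix c assume h: "p s = c *\<^sub>R a i"
    have "c = 0" using arg_cong[OF h, of "\<lambda>v. v \<bullet> e1"] by simp
    then show False using h nonzero by simp
  qed
  show "p s \<notin> span {p t}" if "s \<noteq> t"
  proof (rule c)
    fix c assume h: "p s = c *\<^sub>R p t"
    have "c = 1" using arg_cong[OF h, of "\<lambda>v. v \<bullet> e2"] by simp
    then show False using h that p_eq_iff by simp
  qed
qed

lemma four_power: "(4::real) ^ n = 2 ^ n * 2 ^ n"
  by (simp flip: power_mult_distrib)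

text \<open>The coordinates along \<open>e1\<close> and \<open>e2\<close> determine the
  coefficients, and factoring \<open>4 ^ l - 4 ^ i\<close> as a difference of squares yields the
  slope.\<close>

lemma p_in_span_aa: "i \<noteq> l \<Longrightarrow> p s \<in> span {a i, a l} \<longleftrightarrow> s = 2 ^ i + 2 ^ l"
proof
  assume il: "i \<noteq> l" and "p s \<in> span {a i, a l}"
  then obtain \<alpha> \<beta> where h: "p s = \<alpha> *\<^sub>R a i + \<beta> *\<^sub>R a l" unfolding in_span_pair by blast
  have 1: "\<alpha> = - \<beta>" using arg_cong[OF h, of "\<lambda>v. v \<bullet> e1"] by (simp add: inner_add_left)
  have 2: "\<beta> * (2 ^ l - 2 ^ i) = 1"
    using arg_cong[OF h, of "\<lambda>v. v \<bullet> e2"] 1 by (simp add: inner_add_left algebra_simps)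
  have "s = \<beta> * (4 ^ l - 4 ^ i)"
    using arg_cong[OF h, of "\<lambda>v. v \<bullet> e3"] 1 by (simp add: inner_add_left algebra_simps)
  also have "\<dots> = (\<beta> * (2 ^ l - 2 ^ i)) * (2 ^ i + 2 ^ l)" unfolding four_power by (simp add: algebra_simps)
  finally show "s = 2 ^ i + 2 ^ l" using 2 by simp
next
  assume il: "i \<noteq> l" and s: "s = 2 ^ i + 2 ^ l"
  define \<beta> where "\<beta> = 1 / (2 ^ l - 2 ^ i :: real)"
  have ne: "2 ^ l - 2 ^ i \<noteq> (0::real)" using il by simp
  have 2: "\<beta> * (2 ^ l - 2 ^ i) = 1" unfolding \<beta>_def using ne by simp
  have 3: "\<beta> * (4 ^ l - 4 ^ i) = s"
  proof -
    have "\<beta> * (4 ^ l - 4 ^ i) = (\<beta> * (2 ^ l - 2 ^ i)) * (2 ^ i + 2 ^ l)" unfolding four_power by (simp add: algebra_simps)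
    then show ?thesis using 2 s by simp
  qed
  have "(- \<beta>) *\<^sub>R a i + \<beta> *\<^sub>R a l = (\<beta> * (2 ^ l - 2 ^ i)) *\<^sub>R e2 + (\<beta> * (4 ^ l - 4 ^ i)) *\<^sub>R e3"
    unfolding a_def by (simp add: algebra_simps)
  also have "\<dots> = p s" unfolding 2 3 p_def by simp
  finally show "p s \<in> span {a i, a l}" unfolding in_span_pair by metis
qed

text \<open>A line meets a parabola at most twice; in coordinates this is the same difference of
  squares, cancelled by \<open>2 ^ m - 2 ^ i\<close>.\<close>

lemma a_in_span_aa: "i \<noteq> l \<Longrightarrow> a m \<in> span {a i, a l} \<longleftrightarrow> m = i \<or> m = l"
proof
  assume il: "i \<noteq> l" and "a m \<in> span {a i, a l}"
  then obtain \<alpha> \<beta> where h: "a m = \<alpha> *\<^sub>R a i + \<beta> *\<^sub>R a l" unfolding in_span_pair by blast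
  have 1: "\<alpha> = 1 - \<beta>" using arg_cong[OF h, of "\<lambda>v. v \<bullet> e1"] by (simp add: inner_add_left)
  have 2: "2 ^ m - 2 ^ i = \<beta> * (2 ^ l - 2 ^ i)"
    using arg_cong[OF h, of "\<lambda>v. v \<bullet> e2"] 1 by (simp add: inner_add_left algebra_simps)
  have "2 ^ m * 2 ^ m - 2 ^ i * 2 ^ i = \<beta> * (2 ^ l * 2 ^ l - 2 ^ i * 2 ^ i)"
    using arg_cong[OF h, of "\<lambda>v. v \<bullet> e3"] 1 by (simp add: inner_add_left algebra_simps four_power)
  then have "(2 ^ m - 2 ^ i) * (2 ^ m + 2 ^ i) = (\<beta> * (2 ^ l - 2 ^ i)) * (2 ^ l + 2 ^ i)"
    by (simp add: algebra_simps)
  then have "(2 ^ m - 2 ^ i) * (2 ^ m + 2 ^ i) = (2 ^ m - 2 ^ i) * (2 ^ l + 2 ^ i :: real)"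
    unfolding 2 .
  then show "m = i \<or> m = l" by simp
next
  assume "m = i \<or> m = l"
  then show "a m \<in> span {a i, a l}" using span_base[of "a m" "{a i, a l}"] by auto
qed

lemma p_in_span_ap: "p t \<in> span {a i, p s} \<longleftrightarrow> t = s"
proof
  assume "p t \<in> span {a i, p s}"
  then obtain \<alpha> \<beta> where h: "p t = \<alpha> *\<^sub>R a i + \<beta> *\<^sub>R p s" unfolding in_span_pair by blast
  have 1: "\<alpha> = 0" using arg_cong[OF h, of "\<lambda>v. v \<bullet> e1"] by (simp add: inner_add_left)
  have 2: "\<beta> = 1" using arg_cong[OF h, of "\<lambda>v. v \<bullet> e2"] 1 by (simp add: inner_add_left)
  show "t = s" using h 1 2 p_eq_iff by simp
qed (simp add: span_base)

lemma p_in_span_pp: "s \<noteq> s' \<Longrightarrow> p t \<in> span {p s, p s'}"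
proof -
  assume ne: "s \<noteq> s'"
  define \<beta> where "\<beta> = (t - s) / (s' - s)"
  have "\<beta> * (s' - s) = t - s" unfolding \<beta>_def using ne by simp
  then have 1: "(1 - \<beta>) * s + \<beta> * s' = t" by (simp add: algebra_simps)
  have "(1 - \<beta>) *\<^sub>R p s + \<beta> *\<^sub>R p s' = e2 + ((1 - \<beta>) * s + \<beta> * s') *\<^sub>R e3"
    unfolding p_def by (simp add: algebra_simps)
  also have "\<dots> = p t" unfolding 1 p_def ..
  finally show ?thesis unfolding in_span_pair by metis
qed

text \<open>The cases are no, one, or at least two points of the parabola in \<open>S\<close>. For a
  pair \<open>K = {i, l}\<close> the number \<open>set_encode K\<close> is
  \<open>2 ^ i + 2 ^ l\<close>, the slope of the chord, so \<open>J\<close> consists of the chords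
  whose point at infinity belongs to the configuration.\<close>

lemma rank_two_subsets:
  fixes k :: nat and \<Sigma> :: "real set"
  assumes "finite \<Sigma>"
  defines "M \<equiv> p ` \<Sigma>"
  defines "\<P> \<equiv> {K. K \<subseteq> {..<k} \<and> card K = 2}"
  defines "J \<equiv> {K \<in> \<P>. real (set_encode K) \<in> \<Sigma>}"
  shows "{S. S \<subseteq> a ` {..<k} \<union> M \<and> dim S = 2} =
    {S. S \<subseteq> M \<and> card S \<ge> 2} \<union> (\<lambda>(i, s). {a i, p s}) ` ({..<k} \<times> \<Sigma>)
    \<union> (\<lambda>K. a ` K) ` \<P> \<union> (\<lambda>K. insert (p (real (set_encode K))) (a ` K)) ` J" (is "?L = ?R")
proof
  have enc: "real (set_encode {i, l}) = 2 ^ i + 2 ^ l" if "i \<noteq> l" for i l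
    using that by (simp add: set_encode_def)
  have pairE: "\<exists>i l. K = {i, l} \<and> i \<noteq> l \<and> i < k \<and> l < k" if "K \<in> \<P>" for K
  proof -
    have "card K = 2" "K \<subseteq> {..<k}" using that unfolding \<P>_def by auto
    then show ?thesis unfolding card_2_iff by auto
  qed
  show "?L \<subseteq> ?R"
  proof
    fix S assume "S \<in> ?L"
    then have S: "S \<subseteq> a ` {..<k} \<union> M" "dim S = 2" by auto
    have fS: "finite S" using S(1) assms(1) unfolding M_def by (auto intro: finite_subset)
    consider "\<forall>i<k. a i \<notin> S"
      | i where "i < k" "a i \<in> S" "\<forall>l<k. l \<noteq> i \<longrightarrow> a l \<notin> S"
      | i l where "i < k" "l < k" "i \<noteq> l" "a i \<in> S" "a l \<in> S" by blast
    then show "S \<in> ?R"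
    proof cases
      case 1
      then have "S \<subseteq> M" using S(1) by auto
      moreover have "card S \<ge> 2" using S(2) dim_le_card'[OF fS] by simp
      ultimately show ?thesis by blast
    next
      case 2
      then have SM: "S - {a i} \<subseteq> M" using S(1) by auto
      have "S \<noteq> {a i}"
      proof
        assume "S = {a i}"
        then have "dim S \<le> 1" using dim_le_card'[of "{a i}"] by simp
        then show False using S(2) by simp
      qed
      then obtain x where "x \<in> S" "x \<noteq> a i" using 2(2) by blast
      then obtain s where s: "s \<in> \<Sigma>" "p s \<in> S" using SM unfolding M_def by blast
      have sp: "S \<subseteq> span {a i, p s}"
        using dim_eq_2_iff[OF 2(2) s(2) not_in_span_single(2) nonzero(2)] S(2) by blast
      have "S = {a i, p s}"
      proof
        show "{a i, p s} \<subseteq> S" using 2(2) s(2) by blast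
        show "S \<subseteq> {a i, p s}"
        proof
          fix x assume x: "x \<in> S"
          show "x \<in> {a i, p s}"
          proof (cases "x = a i")
            case False
            then obtain t where t: "x = p t" using x SM unfolding M_def by blast
            have "p t \<in> span {a i, p s}" using subsetD[OF sp x] unfolding t .
            then show ?thesis unfolding p_in_span_ap t by simp
          qed simp
        qed
      qed
      then have "S \<in> (\<lambda>(i, s). {a i, p s}) ` ({..<k} \<times> \<Sigma>)" using 2(1) s(1) by force
      then show ?thesis by blast
    next
      case 3
      have sp: "S \<subseteq> span {a i, a l}"
        using dim_eq_2_iff[OF 3(4,5) not_in_span_single(1)[OF 3(3)] nonzero(1)] S(2) by blast
      let ?K = "{i, l}"
      have K: "?K \<in> \<P>" unfolding \<P>_def using 3 by simp
      have sub: "S \<subseteq> insert (p (2 ^ i + 2 ^ l)) (a ` ?K)"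
      proof
        fix x assume x: "x \<in> S"
        then consider m where "x = a m" | s where "x = p s" using S(1) unfolding M_def by blast
        then show "x \<in> insert (p (2 ^ i + 2 ^ l)) (a ` ?K)"
        proof cases
          case 1
          have "a m \<in> span {a i, a l}" using subsetD[OF sp x] unfolding 1 .
          then show ?thesis unfolding a_in_span_aa[OF 3(3)] 1 by auto
        next
          case 2
          have "p s \<in> span {a i, a l}" using subsetD[OF sp x] unfolding 2 .
          then show ?thesis unfolding p_in_span_aa[OF 3(3)] 2 by simp
        qed
      qed
      show ?thesis
      proof (cases "p (2 ^ i + 2 ^ l) \<in> S")
        case True
        then have "S = insert (p (real (set_encode ?K))) (a ` ?K)" using sub 3 enc[OF 3(3)] by auto
        moreover have "p (2 ^ i + 2 ^ l) \<in> M" using subsetD[OF S(1) True] a_neq_p[symmetric] by auto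
        then have "?K \<in> J" unfolding J_def M_def using K enc[OF 3(3)] p_eq_iff by auto
        ultimately have "S \<in> (\<lambda>K. insert (p (real (set_encode K))) (a ` K)) ` J" by (rule image_eqI)
        then show ?thesis by blast
      next
        case False
        then have "S = a ` ?K" using sub 3 by auto
        then have "S \<in> (\<lambda>K. a ` K) ` \<P>" using K by (rule image_eqI)
        then show ?thesis by blast
      qed
    qed
  qed
  show "?R \<subseteq> ?L"
  proof
    fix S assume "S \<in> ?R"
    then consider "S \<subseteq> M" "card S \<ge> 2" | i s where "i < k" "s \<in> \<Sigma>" "S = {a i, p s}"
      | K where "K \<in> \<P>" "S = a ` K" | K where "K \<in> J" "S = insert (p (real (set_encode K))) (a ` K)"
      by auto
    then show "S \<in> ?L"
    proof cases
      case 1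
      obtain x y where xy: "x \<in> S" "y \<in> S" "x \<noteq> y"
        using 1(2) by (metis One_nat_def card_le_Suc0_iff_eq card_ge_0_finite not_less_eq_eq numeral_2_eq_2 zero_less_Suc less_le_trans)
      then obtain s t where st: "x = p s" "y = p t" "s \<noteq> t" using 1(1) unfolding M_def by blast
      have "S \<subseteq> span {p s, p t}"
      proof
        fix z assume "z \<in> S"
        then obtain r where "z = p r" using 1(1) unfolding M_def by blast
        then show "z \<in> span {p s, p t}" using p_in_span_pp[OF st(3)] by simp
      qed
      then have "dim S = 2"
        using dim_eq_2_iff[of "p s" S "p t"] xy st not_in_span_single(4)[OF st(3)] nonzero(2) by blast
      then show ?thesis using 1 by blast
    next
      case 2
      have "dim S = 2"
        using dim_eq_2_iff[of "a i" S "p s"] not_in_span_single(2) nonzero(2) span_superset[of S]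
        unfolding 2(3) by blast
      then show ?thesis using 2 unfolding M_def by auto
    next
      case 3
      obtain i l where il: "K = {i, l}" "i \<noteq> l" "i < k" "l < k" using pairE[OF 3(1)] by blast
      have S: "S = {a i, a l}" using 3 il by simp
      have "dim S = 2"
        using dim_eq_2_iff[of "a i" S "a l"] not_in_span_single(1)[OF il(2)] nonzero(1) span_superset[of S]
        unfolding S by blast
      then show ?thesis using S il by auto
    next
      case 4
      have KP: "K \<in> \<P>" using 4(1) unfolding J_def by blast
      obtain i l where il: "K = {i, l}" "i \<noteq> l" "i < k" "l < k" using pairE[OF KP] by blast
      have pM: "p (2 ^ i + 2 ^ l) \<in> M" using 4(1) il(1) enc[OF il(2)] unfolding J_def M_def by auto
      have S: "S = {p (2 ^ i + 2 ^ l), a i, a l}" using 4(2) il(1) enc[OF il(2)] by simp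
      have "S \<subseteq> span {a i, a l}"
        unfolding S using p_in_span_aa[OF il(2)] a_in_span_aa[OF il(2)] by simp
      then have "dim S = 2"
        using dim_eq_2_iff[of "a i" S "a l"] not_in_span_single(1)[OF il(2)] nonzero(1)
        unfolding S by blast
      then show ?thesis using S il pM by auto
    qed
  qed
qed

text \<open>All ranks are at most 3. Adding the vanishing sum of \<open>(-1) ^ card S\<close>
  cancels the odd ranks, so only the empty set and the rank two sets listed in
  \<open>rank_two_subsets\<close> have to be counted. Each chord in \<open>J\<close> contributes one
  set of three vectors, hence the loss of \<open>card J\<close>.\<close>

lemma plane_signed_rank_sum:
  fixes k :: nat and \<Sigma> :: "real set"
  assumes \<Sigma>: "finite \<Sigma>" "\<Sigma> \<noteq> {}"
  defines "\<P> \<equiv> {K. K \<subseteq> {..<k} \<and> card K = 2}"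
  defines "J \<equiv> {K \<in> \<P>. real (set_encode K) \<in> \<Sigma>}"
  defines "V \<equiv> a ` {..<k} \<union> p ` \<Sigma>"
  shows "simple_vectors V" "card V = k + card \<Sigma>"
    "signed_rank_sum V = 2 * (int (card \<Sigma>) * (int k + 1) + int (k choose 2) - int (card J))"
proof -
  let ?M = "p ` \<Sigma>"
  have fV: "finite V" unfolding V_def using \<Sigma> by simp
  have inj_a: "inj a" using a_eq_iff by (auto intro: injI)
  have inj_p: "inj p" using p_eq_iff by (auto intro: injI)
  have disj: "a ` {..<k} \<inter> ?M = {}" using a_neq_p by auto
  have cM: "card ?M = card \<Sigma>" using inj_p by (meson card_image inj_on_subset subset_UNIV)
  show sV: "simple_vectors V"
    unfolding simple_vectors_def V_def using fV V_def nonzero not_in_span_single p_eq_iff a_eq_iff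
    by (auto simp: eq_commute[of 0]) (metis)+
  show "card V = k + card \<Sigma>"
    unfolding V_def using disj cM \<Sigma> card_image[OF inj_on_subset[OF inj_a], of "{..<k}"]
    by (subst card_Un_disjoint) auto
  have E: "e1 \<in> span {e1, e2, e3}" "e2 \<in> span {e1, e2, e3}" "e3 \<in> span {e1, e2, e3}"
    by (auto intro: span_base)
  have "a i \<in> span {e1, e2, e3}" "p s \<in> span {e1, e2, e3}" for i s
    unfolding a_def p_def by (intro span_add span_scale E)+
  then have "V \<subseteq> span {e1, e2, e3}" unfolding V_def by blast
  then have dim3: "dim S \<le> 3" if "S \<subseteq> V" for S
  proof -
    have "dim S \<le> dim (span {e1, e2, e3})" using that \<open>V \<subseteq> span {e1, e2, e3}\<close> by (intro dim_subset) blast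
    also have "\<dots> \<le> card {e1, e2, e3}" unfolding dim_span by (rule dim_le_card') simp
    also have "\<dots> \<le> 3" by (simp add: card_insert_if)
    finally show ?thesis .
  qed
  have dim0: "dim S = 0 \<longleftrightarrow> S = {}" if "S \<subseteq> V" for S
    using that sV unfolding simple_vectors_def by auto
  have Vne: "V \<noteq> {}" unfolding V_def using \<Sigma> by simp
  let ?D = "{S. S \<subseteq> V \<and> dim S = 2}"
  have "signed_rank_sum V = (\<Sum>S\<in>Pow V. (-1) ^ (card S + dim S)) + (\<Sum>S\<in>Pow V. (-1) ^ card S)"
    unfolding signed_rank_sum_def using sum_minus_one_card_Pow[OF fV Vne] by simp
  also have "\<dots> = (\<Sum>S\<in>Pow V. (if S = {} then 2 else 0) + (if dim S = 2 then 2 * (-1) ^ card S else 0))"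
    unfolding sum.distrib[symmetric]
  proof (rule sum.cong[OF refl])
    fix S assume "S \<in> Pow V"
    then have SV: "S \<subseteq> V" by simp
    have "dim S = 0 \<or> dim S = 1 \<or> dim S = 2 \<or> dim S = 3" using dim3[OF SV] by linarith
    then show "(-1) ^ (card S + dim S) + (-1) ^ card S
        = (if S = {} then 2 else 0) + (if dim S = 2 then 2 * (-1) ^ card S else (0::int))"
      using dim0[OF SV] by (elim disjE) (auto simp: power_add)
  qed
  also have "\<dots> = 2 + 2 * (\<Sum>S\<in>?D. (-1) ^ card S)"
  proof -
    have "(\<Sum>S\<in>Pow V. if S = {} then 2 else (0::int)) = 2" using fV by (simp add: sum.delta)
    moreover have "(\<Sum>S\<in>Pow V. if dim S = 2 then 2 * (-1) ^ card S else (0::int))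
        = (\<Sum>S\<in>Pow V \<inter> {S. dim S = 2}. 2 * (-1) ^ card S)"
      using fV by (simp add: sum.inter_restrict)
    moreover have "Pow V \<inter> {S. dim S = 2} = ?D" by blast
    ultimately show ?thesis by (simp add: sum.distrib sum_distrib_left)
  qed
  also have "(\<Sum>S\<in>?D. (-1::int) ^ card S)
      = int (card \<Sigma>) - 1 + int k * int (card \<Sigma>) + int (k choose 2) - int (card J)"
  proof -
    define D1 where "D1 = {S. S \<subseteq> ?M \<and> card S \<ge> 2}"
    define D2 where "D2 = (\<lambda>(i, s). {a i, p s}) ` ({..<k} \<times> \<Sigma>)"
    define D3 where "D3 = (\<lambda>K. a ` K) ` \<P>"
    define D4 where "D4 = (\<lambda>K. insert (p (real (set_encode K))) (a ` K)) ` J"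
    have D: "?D = D1 \<union> D2 \<union> D3 \<union> D4"
      using rank_two_subsets[OF \<Sigma>(1), of k] unfolding V_def D1_def D2_def D3_def D4_def J_def \<P>_def .
    have fP: "finite \<P>" unfolding \<P>_def by (rule finite_subset[of _ "Pow {..<k}"]) auto
    have fJ: "finite J" unfolding J_def using fP by simp
    have fM: "finite ?M" using \<Sigma> by simp
    have fin: "finite D1" "finite D2" "finite D3" "finite D4"
      unfolding D1_def D2_def D3_def D4_def using fP fJ fM \<Sigma> by auto
    have finK: "finite K" if "K \<in> \<P>" for K using that unfolding \<P>_def by (auto intro: finite_subset)
    have a_nM: "a i \<notin> ?M" for i using a_neq_p by auto
    have aK: "card (a ` K) = card K" for K using card_image[OF inj_on_subset[OF inj_a], of K] by simp
    have pK: "p s \<notin> a ` K" for s K using a_neq_p by (metis imageE)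
    have ne: "K \<noteq> {}" if "K \<in> \<P>" for K using that unfolding \<P>_def by auto
    have card2: "card S = 2" if "S \<in> D2" for S using that a_neq_p unfolding D2_def by auto
    have card3: "card S = 2" if "S \<in> D3" for S using that aK unfolding D3_def \<P>_def by auto
    have card4: "card S = 3" if S4: "S \<in> D4" for S
    proof -
      obtain K where K: "K \<in> J" "S = insert (p (real (set_encode K))) (a ` K)" using S4 unfolding D4_def by blast
      then have "K \<in> \<P>" unfolding J_def by blast
      then show ?thesis using K(2) pK aK finK[of K] unfolding \<P>_def by simp
    qed
    have d1: "D1 \<inter> D2 = {}" "D1 \<inter> D3 = {}" "D1 \<inter> D4 = {}"
    proof -
      show "D1 \<inter> D2 = {}" unfolding D1_def D2_def using a_nM by auto
      show "D1 \<inter> D3 = {}" unfolding D1_def D3_def using a_nM ne by blast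
      have "K \<noteq> {}" if "K \<in> J" for K using that ne unfolding J_def by blast
      then show "D1 \<inter> D4 = {}" unfolding D1_def D4_def using a_nM by blast
    qed
    have d2: "D2 \<inter> D3 = {}"
    proof (rule equals0I)
      fix S assume S: "S \<in> D2 \<inter> D3"
      obtain i s where "S = {a i, p s}" using S unfolding D2_def by auto
      moreover obtain K where "S = a ` K" using S unfolding D3_def by auto
      ultimately have "p s \<in> a ` K" by blast
      then show False using pK by blast
    qed
    have d3: "(D1 \<union> D2 \<union> D3) \<inter> D4 = {}" using d1(3) card2 card3 card4 by fastforce
    have "(\<Sum>S\<in>?D. (-1::int) ^ card S) = (\<Sum>S\<in>D1. (-1) ^ card S) + (\<Sum>S\<in>D2. (-1) ^ card S)
        + (\<Sum>S\<in>D3. (-1) ^ card S) + (\<Sum>S\<in>D4. (-1) ^ card S)"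
      unfolding D using fin d1 d2 d3
      by (subst sum.union_disjoint; (simp add: Int_Un_distrib2)?)+
    moreover have "(\<Sum>S\<in>D1. (-1::int) ^ card S) = int (card \<Sigma>) - 1"
    proof -
      \<comment> \<open>The alternating sum over all subsets of \<open>?M\<close> is 0; removing the
        empty set and the singletons leaves the sum over \<open>D1\<close>.\<close>
      have P: "Pow ?M = D1 \<union> insert {} ((\<lambda>x. {x}) ` ?M)"
      proof (intro set_eqI iffI)
        fix S assume S: "S \<in> Pow ?M"
        then have "finite S" using fM finite_subset by blast
        show "S \<in> D1 \<union> insert {} ((\<lambda>x. {x}) ` ?M)"
        proof (cases "card S \<ge> 2")
          case True then show ?thesis using S unfolding D1_def by blast
        next
          case False
          then have "card S = 0 \<or> card S = 1" by linarith
          then show ?thesis using S \<open>finite S\<close> by (auto simp: card_1_singleton_iff)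
        qed
      qed (auto simp: D1_def)
      have "D1 \<inter> insert {} ((\<lambda>x. {x}) ` ?M) = {}" unfolding D1_def by auto
      then have "(\<Sum>S\<in>Pow ?M. (-1::int) ^ card S)
          = (\<Sum>S\<in>D1. (-1) ^ card S) + (\<Sum>S\<in>insert {} ((\<lambda>x. {x}) ` ?M). (-1) ^ card S)"
        unfolding P using fin(1) fM by (intro sum.union_disjoint) auto
      moreover have "(\<Sum>S\<in>insert {} ((\<lambda>x. {x}) ` ?M). (-1::int) ^ card S) = 1 - int (card \<Sigma>)"
      proof -
        have "(\<Sum>S\<in>(\<lambda>x. {x}) ` ?M. (-1::int) ^ card S) = (\<Sum>x\<in>?M. -1)"
          by (subst sum.reindex) auto
        then show ?thesis using fM cM by (subst sum.insert) auto
      qed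
      moreover have "(\<Sum>S\<in>Pow ?M. (-1::int) ^ card S) = 0"
        using sum_minus_one_card_Pow[OF fM] \<Sigma>(2) by blast
      ultimately show ?thesis by linarith
    qed
    moreover have "(\<Sum>S\<in>D2. (-1::int) ^ card S) = int k * int (card \<Sigma>)"
    proof -
      have "inj_on (\<lambda>(i, s). {a i, p s}) ({..<k} \<times> \<Sigma>)"
        using a_eq_iff p_eq_iff a_neq_p by (auto simp: inj_on_def doubleton_eq_iff)
      then have "card D2 = k * card \<Sigma>" unfolding D2_def by (simp add: card_image card_cartesian_product)
      then show ?thesis using card2 by simp
    qed
    moreover have "(\<Sum>S\<in>D3. (-1::int) ^ card S) = int (k choose 2)"
    proof -
      have "inj_on (\<lambda>K. a ` K) \<P>" using inj_a by (meson inj_image_eq_iff inj_onI)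
      then have "card D3 = k choose 2"
        unfolding D3_def using n_subsets[of "{..<k}" 2] by (simp add: card_image \<P>_def)
      then show ?thesis using card3 by simp
    qed
    moreover have "(\<Sum>S\<in>D4. (-1::int) ^ card S) = - int (card J)"
    proof -
      have "inj_on (\<lambda>K. insert (p (real (set_encode K))) (a ` K)) J"
      proof (rule inj_onI)
        fix K L assume "insert (p (real (set_encode K))) (a ` K) = insert (p (real (set_encode L))) (a ` L)"
        then have "a ` K = a ` L" using pK by (metis (no_types, lifting) Diff_insert_absorb insert_iff insert_Diff_if singletonD)
        then show "K = L" using inj_a by (simp add: inj_image_eq_iff)
      qed
      then have "card D4 = card J" unfolding D4_def by (simp add: card_image)
      then show ?thesis using card4 by simp
    qed
    ultimately show ?thesis by simp
  qed
  finally show "signed_rank_sum V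
      = 2 * (int (card \<Sigma>) * (int k + 1) + int (k choose 2) - int (card J))"
    by (simp add: algebra_simps)
qed

end

text \<open>Choose \<open>j\<close> chords and let exactly \<open>j\<close> lines of the pencil
  correspond to their slopes; distinct chords have distinct slopes because \<open>set_encode\<close>
  is injective on finite sets.\<close>

lemma plane_vectors:
  assumes "DIM('a::euclidean_space) \<ge> 3" "N \<ge> 1" "j \<le> N" "j \<le> k choose 2"
  shows "\<exists>V :: 'a set. simple_vectors V \<and> card V = N + k \<and>
    signed_rank_sum V = 2 * (int N * (int k + 1) + int (k choose 2) - int j)"
proof -
  obtain E where E: "E \<subseteq> (Basis :: 'a set)" "card E = 3"
    using obtain_subset_with_card_n[OF assms(1)] by metis
  obtain e1 e2 e3 where e: "E = {e1, e2, e3}" "e1 \<noteq> e2" "e1 \<noteq> e3" "e2 \<noteq> e3"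
    using E(2) unfolding card_3_iff by blast
  interpret conic_and_line e1 e2 e3 using e E by unfold_locales auto
  define \<P> where "\<P> = {K. K \<subseteq> {..<k} \<and> card K = 2}"
  have "card \<P> = k choose 2" unfolding \<P>_def using n_subsets[of "{..<k}" 2] by simp
  then obtain J where J: "J \<subseteq> \<P>" "card J = j"
    using obtain_subset_with_card_n[of j \<P>] assms(4) by metis
  have fP: "finite \<P>" unfolding \<P>_def by (rule finite_subset[of _ "Pow {..<k}"]) auto
  have fJ: "finite J" using J(1) fP finite_subset by blast
  have "\<P> \<subseteq> Collect finite" unfolding \<P>_def by (auto intro: finite_subset)
  then have inj: "inj_on (\<lambda>K. real (set_encode K)) \<P>"
    using inj_on_set_encode by (auto simp: inj_on_def)
  let ?\<sigma> = "\<lambda>K. real (set_encode K)" and ?neg = "\<lambda>i::nat. - real (Suc i)"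
  \<comment> \<open>Slopes of chords are nonnegative, so the \<open>N - j\<close> negative numbers
    are slopes of no chord.\<close>
  define \<Sigma> where "\<Sigma> = ?\<sigma> ` J \<union> ?neg ` {..<N - j}"
  have disj: "?\<sigma> ` J \<inter> ?neg ` {..<N - j} = {}"
  proof (intro equals0I)
    fix x assume "x \<in> ?\<sigma> ` J \<inter> ?neg ` {..<N - j}"
    then obtain K i where "x = real (set_encode K)" "x = - real (Suc i)" by blast
    moreover have "real (set_encode K) \<ge> 0" "real (Suc i) > 0" by simp_all
    ultimately show False by linarith
  qed
  have "card (?\<sigma> ` J) = j" using J inj by (metis card_image inj_on_subset)
  moreover have "card (?neg ` {..<N - j}) = N - j"
    by (subst card_image) (auto simp: inj_on_def)
  ultimately have c: "card \<Sigma> = N" unfolding \<Sigma>_def using disj fJ assms(3) by (subst card_Un_disjoint) auto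
  have f: "finite \<Sigma>" unfolding \<Sigma>_def using fJ by simp
  have ne: "\<Sigma> \<noteq> {}" using c assms(2) by auto
  have J_eq: "{K \<in> \<P>. ?\<sigma> K \<in> \<Sigma>} = J"
  proof (intro set_eqI iffI)
    fix K assume K: "K \<in> {K \<in> \<P>. ?\<sigma> K \<in> \<Sigma>}"
    have "?\<sigma> K \<notin> ?neg ` {..<N - j}"
    proof
      assume "?\<sigma> K \<in> ?neg ` {..<N - j}"
      then obtain i where "real (set_encode K) = - real (Suc i)" by blast
      moreover have "real (set_encode K) \<ge> 0" "real (Suc i) > 0" by simp_all
      ultimately show False by linarith
    qed
    then have "?\<sigma> K \<in> ?\<sigma> ` J" using K unfolding \<Sigma>_def by blast
    then obtain L where L: "L \<in> J" "?\<sigma> K = ?\<sigma> L" by blast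
    have "K = L" using inj_onD[OF inj L(2)] K L(1) J(1) by blast
    then show "K \<in> J" using L by simp
  next
    fix K assume "K \<in> J"
    then show "K \<in> {K \<in> \<P>. ?\<sigma> K \<in> \<Sigma>}" unfolding \<Sigma>_def using J(1) by blast
  qed
  note V = plane_signed_rank_sum[OF f ne, of k]
  show ?thesis
    using V c J(2) J_eq unfolding \<P>_def
    by (intro exI[of _ "a ` {..<k} \<union> p ` \<Sigma>"]) (simp add: add.commute)
qed

section \<open>Representing defects by binomial coefficients\<close>

text \<open>Since \<open>0 choose t = 0\<close>, padding \<open>ms\<close> by entries \<open>1\<close> makes \<open>s\<close> a mere upper bound.\<close>

definition binomial_repr :: "nat \<Rightarrow> nat \<Rightarrow> nat \<Rightarrow> bool"
  where "binomial_repr t x s \<longleftrightarrow> (\<exists>ms. sum_list ms = s \<and> (\<Sum>m\<leftarrow>ms. (m - 1) choose t) = x)"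

lemma binomial_repr_0: "t > 0 \<Longrightarrow> binomial_repr t 0 s"
  unfolding binomial_repr_def
  by (intro exI[of _ "replicate s 1"]) (auto simp: sum_list_replicate binomial_eq_0)

lemma binomial_repr_add:
  assumes "binomial_repr t x s" "m \<le> s'" "s = s' - m"
  shows "binomial_repr t (((m - 1) choose t) + x) s'"
proof -
  obtain ms where "sum_list ms = s" "(\<Sum>m\<leftarrow>ms. (m - 1) choose t) = x"
    using assms(1) unfolding binomial_repr_def by blast
  then show ?thesis unfolding binomial_repr_def using assms(2,3) by (intro exI[of _ "m # ms"]) simp
qed

lemma Suc_le_choose: "t > 0 \<Longrightarrow> Suc x \<le> (x + t) choose t"
proof (induction t)
  case (Suc t)
  then show ?case by (cases "t = 0") auto
qed simp

text \<open>The largest binomial coefficient with lower entry \<open>t\<close> not exceeding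
  \<open>x\<close>, which is one step of the greedy representation.\<close>

lemma greedy_choose:
  assumes "t > 0" "x > 0"
  obtains \<mu> where "\<mu> \<ge> t" "(\<mu> choose t) \<le> x" "x < (Suc \<mu> choose t)"
proof -
  define n where "n = (LEAST n. x < n choose t)"
  have ex: "x < (x + t) choose t" using Suc_le_choose[OF assms(1)] by (simp add: Suc_le_eq)
  have n: "x < n choose t" unfolding n_def by (rule LeastI[of "\<lambda>n. x < n choose t", OF ex])
  have "t < n"
  proof (rule ccontr)
    assume "\<not> t < n"
    then have "n choose t \<le> 1" by (cases "n = t") (auto simp: binomial_eq_0)
    then show False using n assms(2) by simp
  qed
  then obtain \<mu> where \<mu>: "n = Suc \<mu>" "t \<le> \<mu>" by (cases n) auto
  have "\<not> x < \<mu> choose t" using not_less_Least[of \<mu> "\<lambda>n. x < n choose t"] \<mu>(1) unfolding n_def by simp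
  then show thesis using that \<mu> n by simp
qed

text \<open>The quotient of the two coefficients is \<open>Suc \<mu> / (Suc \<mu> - t)\<close>,
  largest at \<open>\<mu> = t\<close>. Hence a greedy step removes at least the fraction
  \<open>1 / (t + 1)\<close> of \<open>x\<close>.\<close>

lemma choose_Suc_le:
  assumes "t \<le> \<mu>"
  shows "(Suc \<mu> choose t) \<le> (t + 1) * (\<mu> choose t)"
proof -
  have "(Suc \<mu> - t) * (Suc \<mu> choose t) = Suc \<mu> * (\<mu> choose t)"
    using binomial_absorb_comp[of "Suc \<mu>" t] by simp
  also have "\<dots> \<le> ((Suc \<mu> - t) * (t + 1)) * (\<mu> choose t)"
  proof -
    obtain r where r: "\<mu> = t + r" using assms le_Suc_ex by blast
    have "Suc \<mu> \<le> (Suc \<mu> - t) * (t + 1)" unfolding r by simp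
    then show ?thesis by (rule mult_le_mono1)
  qed
  finally have "(Suc \<mu> - t) * (Suc \<mu> choose t) \<le> (Suc \<mu> - t) * ((t + 1) * (\<mu> choose t))"
    by (simp only: mult.assoc)
  then show ?thesis using assms by (simp only: mult_le_cancel1)
qed

text \<open>Each greedy step multiplies \<open>x\<close> by at most \<open>\<rho>\<close> and uses a
  group of size at most \<open>(t + 1) * root t x\<close>. The sizes are therefore dominated by a
  geometric series with ratio \<open>r = root t \<rho>\<close>, and \<open>B\<close> is its
  sum.\<close>

lemma binomial_repr_root:
  assumes t: "t > 0"
  obtains B :: real where "B > 0" "\<And>x s. B * root t (real x) \<le> real s \<Longrightarrow> binomial_repr t x s"
proof -
  define \<rho> where "\<rho> = real t / (real t + 1)"
  define r where "r = root t \<rho>"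
  have \<rho>: "0 < \<rho>" "\<rho> < 1" unfolding \<rho>_def using t by auto
  have r: "0 < r" "r < 1" unfolding r_def using t \<rho> by (auto simp: real_root_lt_1_iff)
  define B where "B = (real t + 1) / (1 - r)"
  have B0: "B > 0" unfolding B_def using r by simp
  have Br: "B * r = B - (real t + 1)"
  proof -
    have "B * (1 - r) = real t + 1" unfolding B_def using r by simp
    then show ?thesis by (simp add: algebra_simps)
  qed
  have "binomial_repr t x s" if "B * root t (real x) \<le> real s" for x s
    using that
  proof (induction x arbitrary: s rule: less_induct)
    case (less x)
    show ?case
    proof (cases "x = 0")
      case True
      then show ?thesis using binomial_repr_0[OF t] by simp
    next
      case False
      then obtain \<mu> where \<mu>: "\<mu> \<ge> t" "(\<mu> choose t) \<le> x" "x < (Suc \<mu> choose t)"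
        using greedy_choose[OF t, of x] by auto
      define x' where "x' = x - (\<mu> choose t)"
      have pos: "\<mu> choose t > 0" using \<mu>(1) by (simp add: zero_less_binomial_iff)
      have "x' < x" unfolding x'_def using pos \<mu>(2) by linarith
      have x'\<rho>: "real x' \<le> \<rho> * real x"
      proof -
        have "x \<le> (t + 1) * (\<mu> choose t)" using \<mu>(3) choose_Suc_le[OF \<mu>(1)] by linarith
        then have "real x \<le> (real t + 1) * real (\<mu> choose t)"
          by (metis of_nat_1 of_nat_add of_nat_le_iff of_nat_mult)
        then have "real x / (real t + 1) \<le> real (\<mu> choose t)" by (simp add: divide_le_eq mult.commute)
        moreover have "real x' = real x - real (\<mu> choose t)" unfolding x'_def using \<mu>(2) by simp
        moreover have "\<rho> * real x = real x - real x / (real t + 1)" unfolding \<rho>_def by (simp add: field_simps)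
        ultimately show ?thesis by linarith
      qed
      have \<mu>_le: "real (Suc \<mu>) \<le> (real t + 1) * root t (real x)"
      proof -
        have "(real \<mu> / real t) ^ t \<le> real (\<mu> choose t)" by (rule binomial_ge_n_over_k_pow_k[OF \<mu>(1)])
        also have "\<dots> \<le> real x" using \<mu>(2) by simp
        finally have "root t ((real \<mu> / real t) ^ t) \<le> root t (real x)" using t by (simp add: real_root_le_iff)
        then have "real \<mu> / real t \<le> root t (real x)" using t by (simp add: real_root_power_cancel)
        then have "real \<mu> \<le> real t * root t (real x)" using t by (simp add: divide_le_eq mult.commute)
        moreover have "1 \<le> root t (real x)" using False t by (simp add: real_root_ge_1_iff)
        ultimately show ?thesis by (simp add: algebra_simps)
      qed
      have "root t (real x') \<le> root t (\<rho> * real x)" using t x'\<rho> by (simp add: real_root_le_iff)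
      also have "\<dots> = r * root t (real x)" unfolding r_def by (rule real_root_mult)
      finally have "B * root t (real x') \<le> B * (r * root t (real x))" using B0 by simp
      also have "\<dots> = (B * r) * root t (real x)" by simp
      also have "\<dots> = B * root t (real x) - (real t + 1) * root t (real x)" unfolding Br by (simp add: algebra_simps)
      also have "\<dots> \<le> real s - real (Suc \<mu>)" using less.prems \<mu>_le by linarith
      finally have le: "B * root t (real x') \<le> real s - real (Suc \<mu>)" .
      moreover have "0 \<le> B * root t (real x')" using B0 t by simp
      ultimately have "Suc \<mu> \<le> s" by linarith
      then have "B * root t (real x') \<le> real (s - Suc \<mu>)" using le by simp
      then have "binomial_repr t x' (s - Suc \<mu>)" using less.IH[OF \<open>x' < x\<close>] by blast
      then have "binomial_repr t (((Suc \<mu> - 1) choose t) + x') s"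
        using \<open>Suc \<mu> \<le> s\<close> by (intro binomial_repr_add) auto
      then show ?thesis unfolding x'_def using \<mu>(2) by simp
    qed
  qed
  then show thesis using that B0 by blast
qed

text \<open>The previous estimate raised to the power \<open>t\<close>, with \<open>B\<close>
  rounded up, so that later arguments stay within the natural numbers.\<close>

lemma binomial_repr_power:
  assumes t: "t > 0"
  obtains L :: nat where "L > 0" "\<And>x s. L * x \<le> s ^ t \<Longrightarrow> binomial_repr t x s"
proof -
  obtain B :: real where B: "B > 0" "\<And>x s. B * root t (real x) \<le> real s \<Longrightarrow> binomial_repr t x s"
    using binomial_repr_root[OF t] by blast
  define b where "b = nat \<lceil>B\<rceil>"
  have b: "B \<le> real b" unfolding b_def by (simp add: real_nat_ceiling_ge)
  then have b0: "b > 0" using B(1) by (cases b) auto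
  have "binomial_repr t x s" if h: "b ^ t * x \<le> s ^ t" for x s
  proof (rule B(2))
    have "real b ^ t * real x \<le> real s ^ t" using h by (metis of_nat_le_iff of_nat_mult of_nat_power)
    then have "root t (real b ^ t * real x) \<le> root t (real s ^ t)" using t by (simp add: real_root_le_iff)
    then have "real b * root t (real x) \<le> real s" using t by (simp add: real_root_mult real_root_power_cancel)
    moreover have "B * root t (real x) \<le> real b * root t (real x)"
      using b t by (intro mult_right_mono) auto
    ultimately show "B * root t (real x) \<le> real s" by linarith
  qed
  then show thesis using that[of "b ^ t"] b0 by simp
qed

text \<open>By Pascal's rule the difference is a sum of \<open>n - \<nu>\<close> coefficients, each
  at most the last one.\<close>

lemma choose_diff_le:
  assumes "\<nu> \<le> n" "t > 0"
  shows "(n choose t) \<le> (\<nu> choose t) + (n - \<nu>) * ((n - 1) choose (t - 1))"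
  using assms(1)
proof (induction n rule: dec_induct)
  case (step n)
  obtain t' where t': "t = Suc t'" using assms(2) by (cases t) auto
  have "(Suc n choose t) = (n choose t) + (n choose t')" unfolding t' by simp
  also have "\<dots> \<le> (\<nu> choose t) + (n - \<nu>) * ((n - 1) choose t') + (n choose t')"
    using step.IH t' by simp
  also have "\<dots> \<le> (\<nu> choose t) + (n - \<nu>) * (n choose t') + (n choose t')"
    by (intro add_right_mono add_left_mono mult_left_mono binomial_right_mono) auto
  also have "\<dots> = (\<nu> choose t) + (Suc n - \<nu>) * (n choose t')" using step.hyps by (simp add: Suc_diff_le)
  finally show ?case using t' by simp
qed simp

text \<open>Here \<open>x\<close> may be nearly \<open>n choose t\<close>, so no constant factor in
  the total size can be afforded. One greedy group of size \<open>\<mu> + 1\<close> takes almost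
  everything; the remainder is at most \<open>n ^ (t - 1)\<close> and fits into a reserve of
  \<open>s = n div q\<close> once \<open>n\<close> is large.\<close>

lemma binomial_repr_sharp:
  assumes t: "t > 0"
  shows "\<exists>n0. \<forall>n\<ge>n0. \<forall>x. (K + 1) * x \<le> K * (n choose t) \<longrightarrow> binomial_repr t x (n - K - 1)"
proof -
  obtain L where L: "L > 0" "\<And>x s. L * x \<le> s ^ t \<Longrightarrow> binomial_repr t x s"
    using binomial_repr_power[OF t] by blast
  \<comment> \<open>With this \<open>q\<close>, the part \<open>K + 2 + s\<close> of
    \<open>n\<close> withheld from the first group satisfies
    \<open>(K + 1) * t * (K + 2 + s) < n\<close>.\<close>
  define q where "q = 2 * t * (K + 1)"
  have q0: "q > 0" unfolding q_def using t by simp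
  define n0 where "n0 = L * (2 * q) ^ t + 2 * (K + 1) * t * (K + 2) + q + K + t + 2"
  have "binomial_repr t x (n - K - 1)" if n: "n \<ge> n0" and x: "(K + 1) * x \<le> K * (n choose t)" for n x
  proof (cases "x = 0")
    case True
    then show ?thesis using binomial_repr_0[OF t] by simp
  next
    case False
    then obtain \<mu> where \<mu>: "\<mu> \<ge> t" "(\<mu> choose t) \<le> x" "x < (Suc \<mu> choose t)"
      using greedy_choose[OF t, of x] by auto
    define s where "s = n div q"
    define \<nu> where "\<nu> = n - (K + 2 + s)"
    have nbig: "n > 2 * (K + 1) * t * (K + 2)" "n \<ge> q" "n \<ge> L * (2 * q) ^ t" "n \<ge> t" "n > 0"
      using n unfolding n0_def by auto
    have sq: "s * q \<le> n" unfolding s_def by simp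
    have small: "(K + 1) * t * (K + 2 + s) < n"
    proof -
      have "2 * ((K + 1) * t * (K + 2 + s)) = 2 * (K + 1) * t * (K + 2) + s * q"
        unfolding q_def by (simp add: algebra_simps)
      also have "\<dots> < n + n" using nbig(1) sq by linarith
      finally show ?thesis by simp
    qed
    have "1 * (K + 2 + s) \<le> (K + 1) * t * (K + 2 + s)" using t by (intro mult_le_mono1) simp
    then have \<nu>n: "K + 2 + s < n" unfolding mult_1 using small by (rule le_less_trans)
    \<comment> \<open>Lowering \<open>n\<close> to \<open>\<nu>\<close> decreases
      \<open>n choose t\<close> by at most the fraction \<open>t * (K + 2 + s) / n\<close>, which is
      less than \<open>1 / (K + 1)\<close>. So \<open>\<nu> choose t\<close> exceeds the bound
      imposed on \<open>x\<close>.\<close>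
    have "\<mu> < \<nu>"
    proof (rule ccontr)
      assume "\<not> \<mu> < \<nu>"
      then have "(\<nu> choose t) \<le> x" using \<mu>(2) binomial_right_mono[of \<nu> \<mu> t] by simp
      then have 1: "(K + 1) * (\<nu> choose t) \<le> K * (n choose t)" using x by (meson le_trans mult_le_mono2)
      have 2: "(n choose t) \<le> (\<nu> choose t) + (K + 2 + s) * ((n - 1) choose (t - 1))"
        using choose_diff_le[of \<nu> n t] t \<nu>n unfolding \<nu>_def by simp
      have 3: "n * ((n - 1) choose (t - 1)) = t * (n choose t)"
        using binomial_absorption[of "t - 1" n] t by simp
      have pos: "(n choose t) > 0" using nbig(4) by (simp add: zero_less_binomial_iff)
      have "n * ((K + 1) * (n choose t)) \<le> n * ((K + 1) * (\<nu> choose t)) + (K + 1) * (K + 2 + s) * (n * ((n - 1) choose (t - 1)))"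
      proof -
        have "n * ((K + 1) * (n choose t)) \<le> n * ((K + 1) * ((\<nu> choose t) + (K + 2 + s) * ((n - 1) choose (t - 1))))"
          using 2 by (intro mult_le_mono2)
        then show ?thesis by (simp add: algebra_simps)
      qed
      also have "\<dots> \<le> n * (K * (n choose t)) + ((K + 1) * t * (K + 2 + s)) * (n choose t)"
        using 1 unfolding 3 by (intro add_mono mult_le_mono2) (simp_all add: algebra_simps)
      also have "\<dots> < n * (K * (n choose t)) + n * (n choose t)"
        using small pos by (intro add_strict_left_mono mult_strict_right_mono) auto
      finally show False by (simp add: algebra_simps)
    qed
    define x' where "x' = x - (\<mu> choose t)"
    \<comment> \<open>The greedy remainder is smaller than the gap to the next coefficient, which is
      \<open>\<mu> choose (t - 1)\<close>.\<close>
    have "x' \<le> \<mu> ^ (t - 1)"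
    proof -
      obtain t' where t': "t = Suc t'" using t by (cases t) auto
      have "x' \<le> \<mu> choose t'" using \<mu>(3) unfolding x'_def t' by simp
      also have "\<dots> \<le> \<mu> ^ t'" using \<mu>(1) t' by (intro binomial_le_pow) simp
      finally show ?thesis using t' by simp
    qed
    also have "\<dots> \<le> n ^ (t - 1)" using \<open>\<mu> < \<nu>\<close> unfolding \<nu>_def by (intro power_mono) auto
    finally have x': "x' \<le> n ^ (t - 1)" .
    have n2: "n \<le> 2 * q * s"
    proof -
      have "s \<ge> 1" unfolding s_def using nbig(2) q0 by (simp add: div_greater_zero_iff Suc_le_eq)
      moreover have "n < q * s + q" unfolding s_def using q0 by (metis add.commute div_mult_mod_eq mod_less_divisor mult.commute add_less_cancel_left)
      moreover have "q * 1 \<le> q * s" using calculation(1) by (rule mult_le_mono2)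
      moreover have "2 * q * s = q * s + q * s" by simp
      ultimately show ?thesis by linarith
    qed
    have "(L * x') * (2 * q) ^ t \<le> (L * (2 * q) ^ t) * n ^ (t - 1)"
      using x' by simp
    also have "\<dots> \<le> n * n ^ (t - 1)" using nbig(3) by (rule mult_le_mono1)
    also have "\<dots> = n ^ t" using t by (simp add: power_eq_if)
    also have "\<dots> \<le> (2 * q * s) ^ t" using n2 by (rule power_mono) simp
    also have "\<dots> = s ^ t * (2 * q) ^ t" by (simp add: power_mult_distrib)
    finally have "L * x' \<le> s ^ t" using q0 by simp
    then have "binomial_repr t x' s" using L(2) by blast
    moreover have "\<mu> + 1 \<le> n - K - 1 - s" using \<open>\<mu> < \<nu>\<close> unfolding \<nu>_def by linarith
    then have "binomial_repr t 0 (n - K - 1 - s - (\<mu> + 1))" using binomial_repr_0[OF t] by simp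
    ultimately obtain ms ms' where
      "sum_list ms = s" "(\<Sum>m\<leftarrow>ms. (m - 1) choose t) = x'"
      "sum_list ms' = n - K - 1 - s - (\<mu> + 1)" "(\<Sum>m\<leftarrow>ms'. (m - 1) choose t) = 0"
      unfolding binomial_repr_def by blast
    then show ?thesis
      unfolding binomial_repr_def using \<open>\<mu> + 1 \<le> n - K - 1 - s\<close> \<mu>(2) x'_def
      by (intro exI[of _ "(\<mu> + 1) # ms @ ms'"]) simp
  qed
  then show ?thesis by blast
qed

text \<open>Take the least \<open>k \<ge> K\<close> with \<open>(n - k - 1) choose e \<le> D\<close>
  and divide the rest \<open>y\<close> by \<open>k + 1\<close>. If \<open>k > K\<close>, then by
  minimality \<open>y\<close> is below \<open>(n - k - 1) choose (e - 1)\<close>, and dividing by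
  \<open>k + 1 > L1\<close> makes \<open>x\<close> small enough for the power estimate. If
  \<open>k = K\<close>, only \<open>K\<close> times such a coefficient bounds \<open>y\<close>, and
  the sharp estimate is required.\<close>

lemma defect_decomposition:
  assumes e: "e \<ge> 2"
  shows "\<exists>n0. \<forall>n\<ge>n0. \<forall>D<(n - 1) choose e. \<exists>N k x z. N \<ge> 1 \<and> k \<ge> 1 \<and> N + k = n \<and>
    binomial_repr (e - 1) x (N - 1) \<and> binomial_repr e z (k - 1) \<and>
    D = ((N - 1) choose e) + (k + 1) * x + z"
proof -
  have e0: "e > 0" "e - 1 > 0" using e by auto
  obtain L1 where L1: "\<And>x s. L1 * x \<le> s ^ (e - 1) \<Longrightarrow> binomial_repr (e - 1) x s"
    using binomial_repr_power[OF e0(2)] by metis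
  obtain L2 where L2: "\<And>x s. L2 * x \<le> s ^ e \<Longrightarrow> binomial_repr e x s"
    using binomial_repr_power[OF e0(1)] by metis
  define K where "K = L1 + L2 + 3"
  obtain n1 where n1: "\<And>n x. n \<ge> n1 \<Longrightarrow> (K + 1) * x \<le> K * (n choose (e - 1)) \<Longrightarrow> binomial_repr (e - 1) x (n - K - 1)"
    using binomial_repr_sharp[OF e0(2), of K] by blast
  \<comment> \<open>A remainder modulo \<open>k + 1\<close> is at most \<open>k\<close>, while the
    available \<open>(k - 1) ^ e\<close> is at least quadratic in \<open>k - 1\<close>;
    \<open>K\<close> is large enough for this to absorb \<open>L2\<close>.\<close>
  have z_repr: "binomial_repr e z (k - 1)" if Kk: "K \<le> k" "z \<le> k" for z k
  proof (rule L2)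
    obtain r where r: "k = Suc r" "r \<ge> L2 + 2" using Kk(1) unfolding K_def by (cases k) auto
    have "L2 * z \<le> L2 * k" using Kk(2) by simp
    also have "\<dots> \<le> (L2 + 2) * r" using r by (simp add: algebra_simps)
    also have "\<dots> \<le> r * r" using r(2) by (rule mult_le_mono1)
    also have "\<dots> = r ^ 2" by (simp add: power2_eq_square)
    also have "\<dots> \<le> r ^ e" using r(2) e by (intro power_increasing) auto
    finally show "L2 * z \<le> (k - 1) ^ e" using r(1) by simp
  qed
  have "\<exists>N k x z. N \<ge> 1 \<and> k \<ge> 1 \<and> N + k = n \<and>
    binomial_repr (e - 1) x (N - 1) \<and> binomial_repr e z (k - 1) \<and>
    D = ((N - 1) choose e) + (k + 1) * x + z"
    if n: "n \<ge> n1 + K + 2" and D: "D < (n - 1) choose e" for n D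
  proof -
    define h where "h k = (n - k - 1) choose e" for k
    define k where "k = (LEAST k. K \<le> k \<and> h k \<le> D)"
    have ex: "K \<le> n - 1 \<and> h (n - 1) \<le> D" using n e0 unfolding h_def by (simp add: binomial_eq_0)
    have k: "K \<le> k" "h k \<le> D" unfolding k_def using LeastI[of "\<lambda>k. K \<le> k \<and> h k \<le> D", OF ex] by auto
    have kn: "k \<le> n - 1" unfolding k_def using Least_le[of "\<lambda>k. K \<le> k \<and> h k \<le> D", OF ex] .
    define y where "y = D - h k"
    define x where "x = y div (k + 1)"
    define z where "z = y mod (k + 1)"
    have y: "y = (k + 1) * x + z" unfolding x_def z_def by (rule mult_div_mod_eq[symmetric])
    have zk: "z \<le> k" unfolding z_def using mod_less_divisor[of "k + 1" y] by linarith
    have "binomial_repr (e - 1) x (n - k - 1)"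
    proof (cases "k = K")
      case True
      \<comment> \<open>Minimality says nothing at \<open>k = K\<close>; instead
        \<open>D < h 0\<close> is used, and \<open>h\<close> drops by at most \<open>K\<close>
        coefficients between 0 and \<open>K\<close>.\<close>
      have "h 0 \<le> h K + K * ((n - 2) choose (e - 1))"
      proof -
        have "n - K - 1 \<le> n - 1" "n - 1 - (n - K - 1) = K" "n - 1 - 1 = n - 2" "n - 0 - 1 = n - 1"
          using n by linarith+
        then show ?thesis using choose_diff_le[of "n - K - 1" "n - 1" e] e0(1) unfolding h_def by metis
      qed
      moreover have "D < h 0" using D unfolding h_def by simp
      ultimately have "y \<le> K * ((n - 2) choose (e - 1))"
        unfolding y_def True by linarith
      also have "\<dots> \<le> K * (n choose (e - 1))" by (intro mult_le_mono2 binomial_right_mono) simp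
      finally have "(K + 1) * x \<le> K * (n choose (e - 1))" using y True by simp
      then show ?thesis using n1[of n x] n True by simp
    next
      case False
      then obtain i where i: "k = Suc i" "K \<le> i" using k(1) by (cases k) auto
      have "\<not> (K \<le> i \<and> h i \<le> D)"
        using not_less_Least[of i "\<lambda>k. K \<le> k \<and> h k \<le> D"] i(1) unfolding k_def by simp
      then have "D < h i" using i(2) by simp
      moreover have "h i = h k + ((n - k - 1) choose (e - 1))"
      proof -
        have "n - i - 1 = Suc (n - k - 1)" using kn n i(1) unfolding K_def by linarith
        moreover obtain e' where "e = Suc e'" using e by (cases e) auto
        ultimately show ?thesis unfolding h_def by simp
      qed
      ultimately have y1: "y < (n - k - 1) choose (e - 1)" using k(2) unfolding y_def by linarith
      then have le: "e - 1 \<le> n - k - 1" using binomial_eq_0[of "n - k - 1" "e - 1"] by (metis not_less not_less_zero)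
      have "L1 * x \<le> (k + 1) * x" using k(1) unfolding K_def by (intro mult_le_mono1) simp
      also have "\<dots> \<le> (n - k - 1) choose (e - 1)" using y y1 by linarith
      also have "\<dots> \<le> (n - k - 1) ^ (e - 1)" by (rule binomial_le_pow[OF le])
      finally show ?thesis by (rule L1)
    qed
    moreover have "binomial_repr e z (k - 1)" by (rule z_repr[OF k(1) zk])
    moreover have "D = ((n - k - 1) choose e) + (k + 1) * x + z" using k(2) y unfolding y_def h_def by simp
    moreover have "n - k \<ge> 1" "k \<ge> 1" "(n - k) + k = n" using kn n k(1) unfolding K_def by auto
    ultimately show ?thesis by (intro exI[of _ "n - k"] exI[of _ k] exI[of _ x] exI[of _ z]) auto
  qed
  then show ?thesis by blast
qed

section \<open>Realizable numbers of regions\<close>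

text \<open>The number \<open>F n e\<close> of the overview.\<close>

definition regions_bound :: "nat \<Rightarrow> nat \<Rightarrow> nat"
  where "regions_bound n e = (\<Sum>j\<le>e. (n - 1) choose j)"

lemma arrangement_of_vectorsE:
  fixes V :: "(real ^ 'n :: finite) set"
  assumes "simple_vectors V" "card V = n" "n > 0" "signed_rank_sum V = 2 * int f"
  shows "\<exists>A :: 'n proj_space set set. A \<in> arrangements n \<and> num_regions A = f"
proof -
  have "V \<noteq> {}" using assms(2,3) by auto
  then show ?thesis using arrangement_of_vectors[OF assms(1) _ assms(4)] assms(2) by auto
qed

lemma f_max_le:
  assumes "CARD('n :: finite) = d + 1" "d \<ge> 2" "n > 0"
  shows "f_max TYPE('n) n \<le> regions_bound n d"
proof -
  let ?S = "num_regions ` (arrangements n :: 'n proj_space set set set)"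
  have le: "r \<le> regions_bound n d" if r: "r \<in> ?S" for r
  proof -
    obtain A :: "'n proj_space set set" where "A \<in> arrangements n" "r = num_regions A" using r by blast
    then show ?thesis
      using num_regions_le[of A n] assms(1,3) unfolding regions_bound_def by (simp add: lessThan_Suc_atMost)
  qed
  then have "finite ?S" by (intro finite_subset[of ?S "{..regions_bound n d}"]) auto
  \<comment> \<open>\<open>Max\<close> is meaningful only for a nonempty finite set. The witness is
    one pencil line with \<open>n - 1\<close> generic lines and no coincidences.\<close>
  moreover have "?S \<noteq> {}"
  proof -
    have "DIM(real ^ 'n) \<ge> 3" using assms(1,2) by simp
    then obtain V :: "(real ^ 'n) set" where "simple_vectors V" "card V = 1 + (n - 1)"
      "signed_rank_sum V = 2 * (int 1 * (int (n - 1) + 1) + int ((n - 1) choose 2) - int 0)"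
      using plane_vectors[where 'a = "real ^ 'n", of 1 0 "n - 1"] by auto
    then have "\<exists>A :: 'n proj_space set set. A \<in> arrangements n \<and> num_regions A = n + ((n - 1) choose 2)"
      using assms(3) by (intro arrangement_of_vectorsE) auto
    then show ?thesis by blast
  qed
  ultimately show ?thesis unfolding f_max_def using le by (simp add: Max_le_iff)
qed

text \<open>With \<open>\<kappa> = k + 1\<close> and \<open>s = sqrt (2 n)\<close>, the right-hand
  side of the last assumption is the largest count \<open>(n - k) (k + 1) + (k choose 2)\<close> for
  \<open>k\<close>, and the conclusion says \<open>n - k - 2 \<le> k choose 2\<close>. Were it
  false, then \<open>\<kappa> < s + 1 / 2\<close>, and the assumption would force
  \<open>\<kappa> * \<kappa> + \<kappa> \<le> n + 2\<close>. But it also forces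
  \<open>s \<le> \<kappa> + 1\<close>, so \<open>\<kappa> * \<kappa>\<close> would be near
  \<open>2 * n\<close>.\<close>

lemma plane_threshold:
  fixes n \<kappa> s :: real
  assumes n: "n \<ge> 8" and \<kappa>: "\<kappa> \<ge> 0" and s: "s \<ge> 0" "s * s = 2 * n"
    and le: "s * n \<le> n * \<kappa> - \<kappa> * (\<kappa> + 1) / 2 + 1"
  shows "2 * n - 4 \<le> \<kappa> * (\<kappa> - 1)"
proof (rule ccontr)
  assume "\<not> ?thesis"
  then have lt: "\<kappa> * (\<kappa> - 1) < 2 * n - 4" by simp
  have "\<kappa> < s + 1 / 2"
  proof (rule ccontr)
    assume "\<not> \<kappa> < s + 1 / 2"
    then have "s * s \<le> (\<kappa> - 1 / 2) * (\<kappa> - 1 / 2)" using s(1) by (intro mult_mono) auto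
    then show False using lt s(2) by (simp add: algebra_simps)
  qed
  then have "n * (\<kappa> - s) \<le> n * (1 / 2)" using n by (intro mult_left_mono) auto
  then have "n * \<kappa> - n * s \<le> n / 2" by (simp add: algebra_simps)
  moreover have le2: "2 * (n * s) \<le> 2 * (n * \<kappa>) - (\<kappa> * \<kappa> + \<kappa>) + 2"
    using le by (simp add: field_simps)
  ultimately have 2: "\<kappa> * \<kappa> + \<kappa> \<le> n + 2" by linarith
  have 3: "s \<le> \<kappa> + 1"
  proof (rule ccontr)
    assume "\<not> s \<le> \<kappa> + 1"
    then have "(\<kappa> + 1) * n \<le> s * n" using n by (intro mult_right_mono) auto
    moreover have "0 \<le> \<kappa> * (\<kappa> + 1)" using \<kappa> by simp
    ultimately show False using le2 n by (simp add: algebra_simps)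
  qed
  then have "s * s \<le> (\<kappa> + 1) * (\<kappa> + 1)" using s(1) by (intro mult_mono) auto
  then have 4: "n - 3 \<le> \<kappa>" using 2 s(2) by (simp add: algebra_simps)
  then have "(n - 3) * (n - 3) \<le> \<kappa> * \<kappa>" using n by (intro mult_mono) auto
  moreover have "5 * (n - 3) \<le> (n - 3) * (n - 3)" using n by (intro mult_right_mono) auto
  ultimately have "5 * (n - 3) \<le> \<kappa> * \<kappa>" by (rule order_trans[rotated])
  then have "5 * n - 15 \<le> \<kappa> * \<kappa>" by simp
  then have "5 * n - 15 + (n - 3) \<le> n + 2" using 2 4 by linarith
  then show False using n by simp
qed

text \<open>Let \<open>k\<close> be least with \<open>f \<le> G k\<close>. Since \<open>G\<close>
  grows by \<open>N - 1\<close> in the last step, the number \<open>j\<close> of coincidences needed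
  is at most \<open>N - 2\<close>, and \<open>plane_threshold\<close> shows that this many
  intersection points are available.\<close>

lemma planar_region_counts:
  fixes n f :: nat
  assumes card: "CARD('n :: finite) = d + 1" "d \<ge> 2" and n: "n \<ge> 8"
    and f: "sqrt (2 * real n) * real n \<le> real f" "f \<le> regions_bound n 2"
  shows "\<exists>A :: 'n proj_space set set. A \<in> arrangements n \<and> num_regions A = f"
proof -
  define G :: "nat \<Rightarrow> nat" where "G k = (n - k) * (k + 1) + (k choose 2)" for k
  have "G (n - 1) = regions_bound n 2"
  proof -
    have "(\<Sum>j\<le>2. (n - 1) choose j) = 1 + (n - 1) + ((n - 1) choose 2)"
      by (simp add: numeral_2_eq_2)
    moreover have "n - (n - 1) = 1" using n by simp
    ultimately show ?thesis unfolding G_def regions_bound_def using n by simp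
  qed
  then have ex: "f \<le> G (n - 1)" using f(2) by simp
  define k where "k = (LEAST k. f \<le> G k)"
  have k: "f \<le> G k" unfolding k_def by (rule LeastI[of "\<lambda>k. f \<le> G k", OF ex])
  have kn: "k \<le> n - 1" unfolding k_def by (rule Least_le[of "\<lambda>k. f \<le> G k", OF ex])
  \<comment> \<open>\<open>G 0 = n\<close> lies below the lower end of the range of
    \<open>f\<close>.\<close>
  have "k \<noteq> 0"
  proof
    assume "k = 0"
    then have "f \<le> n" using k unfolding G_def by (simp add: numeral_2_eq_2)
    moreover have "1 < sqrt (2 * real n)" using n by simp
    then have "1 * real n < sqrt (2 * real n) * real n" using n by (intro mult_strict_right_mono) auto
    ultimately show False using f(1) by simp
  qed
  then obtain i where i: "k = Suc i" by (cases k) auto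
  have Gi_less: "\<not> f \<le> G i" using not_less_Least[of i "\<lambda>k. f \<le> G k"] i unfolding k_def by simp
  define N where "N = n - k"
  have N: "N \<ge> 1" "N + k = n" unfolding N_def using kn n by auto
  have Gk: "G k = N * (k + 1) + (k choose 2)" unfolding G_def N_def ..
  have Gi: "G i + N = G k + 1"
  proof -
    have "n - i = Suc N" unfolding N_def using kn n i by linarith
    then have "G i = Suc N * (i + 1) + (i choose 2)" unfolding G_def by simp
    moreover have "(k choose 2) = (i choose 2) + i" unfolding i by (simp add: numeral_2_eq_2)
    ultimately show ?thesis using Gk unfolding i by simp
  qed
  define j where "j = G k - f"
  have jN: "j + 2 \<le> N" using Gi Gi_less k unfolding j_def by linarith
  have jk: "j \<le> k choose 2"
  proof -
    have choose2: "real (k choose 2) = real k * (real k - 1) / 2"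
    proof -
      have "2 * (k choose 2) = k * (k - 1)" unfolding choose_two i by (intro dvd_mult_div_cancel) simp
      then have "2 * real (k choose 2) = real k * real (k - 1)" by (metis of_nat_mult of_nat_numeral)
      then show ?thesis using i by simp
    qed
    have nN: "real N = real n - real k" using N by simp
    have "real f \<le> real (G k)" using k by simp
    also have "\<dots> = real n * (real k + 1) - (real k + 1) * (real k + 1 + 1) / 2 + 1"
      unfolding Gk by (simp add: choose2 nN field_simps)
    finally have "sqrt (2 * real n) * real n \<le> real n * (real k + 1) - (real k + 1) * (real k + 1 + 1) / 2 + 1"
      using f(1) by linarith
    then have "2 * real n - 4 \<le> (real k + 1) * (real k + 1 - 1)"
      using n by (intro plane_threshold[of "real n" "real k + 1" "sqrt (2 * real n)"]) auto
    then have "real N \<le> real (k choose 2) + 2" unfolding choose2 nN by (simp add: field_simps)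
    then show ?thesis using jN by linarith
  qed
  have "DIM(real ^ 'n) \<ge> 3" using card by simp
  then obtain V :: "(real ^ 'n) set" where V: "simple_vectors V" "card V = N + k"
    "signed_rank_sum V = 2 * (int N * (int k + 1) + int (k choose 2) - int j)"
    using plane_vectors[where 'a = "real ^ 'n", of N j k] N(1) jN jk by auto
  have "int N * (int k + 1) + int (k choose 2) - int j = int (G k) - int j" unfolding Gk by (simp add: algebra_simps)
  also have "\<dots> = int f" unfolding j_def using k by simp
  finally have "signed_rank_sum V = 2 * int f" using V(3) by simp
  then show ?thesis using V N n by (intro arrangement_of_vectorsE[of V]) auto
qed

text \<open>The interval has length \<open>(n - 1) choose e\<close>, which is the range of defects
  that \<open>defect_decomposition\<close> covers. For \<open>e < d\<close> the normals span a
  proper subspace.\<close>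

lemma spatial_region_counts:
  assumes card: "CARD('n :: finite) = d + 1" and e: "3 \<le> e" "e \<le> d"
  shows "\<forall>\<^sub>F n in sequentially. \<forall>f. regions_bound n (e - 1) < f \<and> f \<le> regions_bound n e \<longrightarrow>
    (\<exists>A :: 'n proj_space set set. A \<in> arrangements n \<and> num_regions A = f)"
proof -
  have "e \<ge> 2" using e by simp
  then obtain n0 where n0: "\<And>n D. n \<ge> n0 \<Longrightarrow> D < (n - 1) choose e \<Longrightarrow> \<exists>N k x z. N \<ge> 1 \<and> k \<ge> 1 \<and> N + k = n \<and>
      binomial_repr (e - 1) x (N - 1) \<and> binomial_repr e z (k - 1) \<and>
      D = ((N - 1) choose e) + (k + 1) * x + z"
    using defect_decomposition by meson
  have "\<exists>A :: 'n proj_space set set. A \<in> arrangements n \<and> num_regions A = f"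
    if n: "n \<ge> n0" and f: "regions_bound n (e - 1) < f" "f \<le> regions_bound n e" for n f
  proof -
    define D where "D = regions_bound n e - f"
    have "regions_bound n e = regions_bound n (e - 1) + ((n - 1) choose e)"
      using e(1) unfolding regions_bound_def by (cases e) auto
    then have "D < (n - 1) choose e" using f unfolding D_def by linarith
    then obtain N k x z where *: "N \<ge> 1" "k \<ge> 1" "N + k = n"
      "binomial_repr (e - 1) x (N - 1)" "binomial_repr e z (k - 1)"
      "D = ((N - 1) choose e) + (k + 1) * x + z"
      using n0[OF n] by blast
    obtain ps where ps: "sum_list ps = N - 1" "(\<Sum>p\<leftarrow>ps. (p - 1) choose (e - 1)) = x"
      using *(4) unfolding binomial_repr_def by blast
    obtain ms where ms: "sum_list ms = k - 1" "(\<Sum>m\<leftarrow>ms. (m - 1) choose e) = z"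
      using *(5) unfolding binomial_repr_def by blast
    have "Suc e \<le> DIM(real ^ 'n)" "sum_list ps + 1 = N" "sum_list ms + 1 = k"
      using card e(2) ps(1) ms(1) *(1,2) by simp_all
    from two_level_vectors[OF e(1) this] obtain V :: "(real ^ 'n) set" where V: "simple_vectors V" "card V = N + k"
      "signed_rank_sum V = 2 * (int (\<Sum>j\<le>e. (N + k - 1) choose j) - int ((N - 1) choose e)
        - int (k + 1) * int x - int z)"
      unfolding ps(2) ms(2) by blast
    have "int (\<Sum>j\<le>e. (N + k - 1) choose j) - int ((N - 1) choose e) - int (k + 1) * int x - int z
        = int (regions_bound n e) - int D"
      unfolding *(6) *(3) regions_bound_def by (simp add: algebra_simps)
    also have "\<dots> = int f" unfolding D_def using f(2) by simp
    finally have "signed_rank_sum V = 2 * int f" using V(3) by simp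
    then show ?thesis using V *(1,3) by (intro arrangement_of_vectorsE[of V]) auto
  qed
  then show ?thesis unfolding eventually_sequentially by blast
qed

theorem theorem3:
  fixes d :: nat
  assumes "CARD('n :: finite) = d + 1" and "d \<ge> 4"
  shows "\<forall>\<^sub>F n in sequentially. \<forall>f :: int.
    sqrt (2 * real n) * real n \<le> real_of_int f \<and> f \<le> int (f_max TYPE('n) n) \<longrightarrow>
    (\<exists>A :: 'n proj_space set set. A \<in> arrangements n \<and> int (num_regions A) = f)"
proof -
  \<comment> \<open>The dimensions \<open>e\<close> form a finite set, so one threshold for
    \<open>n\<close> serves them all.\<close>
  have "\<forall>\<^sub>F n in sequentially. \<forall>e\<in>{3..d}. \<forall>f. regions_bound n (e - 1) < f \<and> f \<le> regions_bound n e \<longrightarrow>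
    (\<exists>A :: 'n proj_space set set. A \<in> arrangements n \<and> num_regions A = f)"
    using spatial_region_counts[OF assms(1)] by (intro eventually_ball_finite) auto
  moreover have "\<forall>\<^sub>F n in sequentially. n \<ge> (8::nat)" by (rule eventually_ge_at_top)
  ultimately show ?thesis
  proof eventually_elim
    case (elim n)
    show ?case
    proof (intro allI impI)
      fix f :: int
      assume f: "sqrt (2 * real n) * real n \<le> real_of_int f \<and> f \<le> int (f_max TYPE('n) n)"
      have "0 \<le> sqrt (2 * real n) * real n" by simp
      then have "0 \<le> f" using f by linarith
      then obtain g where g: "f = int g" using nonneg_int_cases by blast
      have "g \<le> f_max TYPE('n) n" using f g by simp
      also have "\<dots> \<le> regions_bound n d" using assms elim(2) by (intro f_max_le) auto
      finally have gd: "g \<le> regions_bound n d" .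
      have "\<exists>A :: 'n proj_space set set. A \<in> arrangements n \<and> num_regions A = g"
      proof (cases "g \<le> regions_bound n 2")
        case True
        then show ?thesis
          using planar_region_counts[OF assms(1) _ elim(2), of g] assms(2) f g by simp
      next
        case False
        \<comment> \<open>The least \<open>e\<close> puts \<open>g\<close> into the interval between
          the bounds for \<open>e - 1\<close> and \<open>e\<close>; the planar case being excluded,
          \<open>e\<close> is at least 3.\<close>
        define e where "e = (LEAST e. g \<le> regions_bound n e)"
        have e: "g \<le> regions_bound n e" unfolding e_def by (rule LeastI[of "\<lambda>e. g \<le> regions_bound n e", OF gd])
        have "e \<le> d" unfolding e_def by (rule Least_le[of "\<lambda>e. g \<le> regions_bound n e", OF gd])
        have "\<not> e \<le> 2"
        proof
          assume "e \<le> 2"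
          then have "regions_bound n e \<le> regions_bound n 2"
            unfolding regions_bound_def by (intro sum_mono2) auto
          then show False using e False by simp
        qed
        then have "e - 1 < e" "e \<in> {3..d}" using \<open>e \<le> d\<close> by auto
        moreover have "\<not> g \<le> regions_bound n (e - 1)"
          using not_less_Least[of "e - 1" "\<lambda>e. g \<le> regions_bound n e"] calculation(1) unfolding e_def by blast
        ultimately show ?thesis using elim(1) e by (meson not_le)
      qed
      then show "\<exists>A :: 'n proj_space set set. A \<in> arrangements n \<and> int (num_regions A) = f"
        using g by auto
    qed
  qed
qed

end
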